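(* Let $\dot x=f(x,\mu)$, $x\in\mathbb R^n$, be a smooth one-parameter family of systems undergoing a supercritical Hopf bifurcation at $\mu=\mu_c$, with the parameter oriented so that the stable periodic branch exists for $\mu>\mu_c$. For $\mu$ in a neighborhood $J$ of $\mu_c$, let $A_\mu=\{x^*(\mu)\}$ (the stable equilibrium) if $\mu<\mu_c$ and $A_\mu=\Gamma_\mu$ (the stable periodic orbit) if $\mu>\mu_c$. Let $\Phi_\mu$ be the delay-coordinate map into $\mathbb R^m$ with embedding parameters $(\tau,m)$ common to all $\mu$, assume that $\Phi_\mu$ is an embedding on the attracting set $A_\mu$, and put $M_\mu:=\Phi_\mu(A_\mu)\subset\mathbb R^m$. For $\mu>\mu_c$, let $P_\mu\subset M_\mu$ be a finite set with $d_H(P_\mu,M_\mu)\le\delta_\mu$, let $R_\mu:=\operatorname{rch}(M_\mu)>0$, and assume $$\delta_\mu<\tfrac12\sqrt{\tfrac{3}{10}}\,R_\mu .$$ For $\mu<\mu_c$, let $P_\mu=M_\mu$ (a single point). Let $\widetilde X_\mu\subset\mathbb R^m$ be a finite point cloud (the reconstruction from the observed time series) with $$d_H(P_\mu,\widetilde X_\mu)\le q_\mu ,$$ and let $\widetilde{\mathcal H}(\mu):=\mathscr H(\widetilde X_\mu)$, where $\mathscr H$ denotes the maximal one-dimensional Vietoris--Rips persistence. Then, for $\mu\in J$: (i) if $\mu<\mu_c$, then $\widetilde{\mathcal H}(\mu)\le 4q_\mu$; (ii) if $\mu>\mu_c$, then, with $$\eta_\mu^{\mathrm{geom}}:=2\left(\sqrt{\tfrac{3}{10}}\,R_\mu-2\delta_\mu\right)>0,$$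 one has $$\widetilde{\mathcal H}(\mu)\ge \eta_\mu^{\mathrm{geom}}-4q_\mu .$$ In particular, whenever $\eta_\mu^{\mathrm{geom}}>4q_\mu$, the one-dimensional persistence diagram of $\widetilde X_\mu$ contains a nontrivial class whose persistence is bounded away from zero (it is at least $\eta_\mu^{\mathrm{geom}}-4q_\mu>0$).
   Context: Supercritical Hopf bifurcation: as $\mu$ crosses $\mu_c$, a pair of complex conjugate eigenvalues of the Jacobian at the equilibrium crosses the imaginary axis with nonzero imaginary part, under the usual nondegeneracy conditions and with negative first Lyapunov coefficient; with the chosen orientation the equilibrium $x^*(\mu)$ is stable for $\mu<\mu_c$, and a stable periodic orbit $\Gamma_\mu$ (a simple closed curve) exists for $\mu>\mu_c$ near $\mu_c$. Delay-coordinate map: given a scalar observation of the state producing the time series $x(t;\mu)$, a delay $\tau>0$ and a dimension $m\ge1$, the delay vectors are $\Phi_\mu(t)=(x(t;\mu),x(t-\tau;\mu),\dots,x(t-(m-1)\tau;\mu))\in\mathbb R^m$; as a map on the attracting set, $\Phi_\mu$ sends a state to the vector of observations of that state evolved backward by $0,\tau,\dots,(m-1)\tau$. "Embedding" means an embedding in the sense of Takens' theorem; in particular $M_\mu$ is a single point for $\mu<\mu_c$ and an embedded simple closed curve for $\mu>\mu_c$. Hausdorff distance for compact $A,B\subset\mathbb R^m$: $d_H(A,B)=\max\{\sup_{a\in A}\inf_{b\in B}\|a-b\|,\ \sup_{b\in B}\inf_{a\in A}\|a-b\|\}$, with the Euclidean norm. Reach: for compact $K\subset\mathbb R^m$, $\operatorname{rch}(K)$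 is the supremum of the $r>0$ such that every point at distance less than $r$ from $K$ has a unique nearest point in $K$. Vietoris--Rips complex: for finite $Y\subset\mathbb R^m$ and $\varepsilon\ge0$, $\mathrm{VR}(Y,\varepsilon)$ is the simplicial complex whose simplices are the nonempty subsets of $Y$ with all pairwise Euclidean distances at most $\varepsilon$. Homology is taken with coefficients in $\mathbb F_2$. $D^{(1)}(Y)=\{(b_i,d_i)\}$ is the degree-one persistence diagram of the filtration $\{\mathrm{VR}(Y,\varepsilon)\}_{\varepsilon\ge0}$, and the persistence of a point $(b,d)$ is $d-b$. Dominant topological functional: $\mathscr H(Y):=\max_{(b,d)\in D^{(1)}(Y)}(d-b)$, with $\mathscr H(Y)=0$ if $D^{(1)}(Y)$ has no off-diagonal points. *)

theory Defs
  imports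
    "HOL-Analysis.Analysis"
    "HOL-Library.Multiset"
    "HOL-Library.Poly_Mapping"
    "HOL-Library.Z2"
begin

section \<open>Smooth families of vector fields\<close>

text \<open>
  Intended for open \<^term>\<open>S\<close> only.
\<close>

primrec Ck_on :: "nat \<Rightarrow> 'a::euclidean_space set \<Rightarrow> ('a \<Rightarrow> 'b::real_normed_vector) \<Rightarrow> bool" where
  "Ck_on 0 S g \<longleftrightarrow> continuous_on S g"
| "Ck_on (Suc k) S g \<longleftrightarrow>
     (\<forall>x\<in>S. g differentiable (at x)) \<and>
     (\<forall>v\<in>Basis. Ck_on k S (\<lambda>x. frechet_derivative g (at x) v))"

definition smooth_on :: "'a::euclidean_space set \<Rightarrow> ('a \<Rightarrow> 'b::real_normed_vector) \<Rightarrow> bool" where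
  "smooth_on S g \<longleftrightarrow> (\<forall>k. Ck_on k S g)"

definition solves_ode :: "('a::real_normed_vector \<Rightarrow> 'a) \<Rightarrow> (real \<Rightarrow> 'a) \<Rightarrow> real set \<Rightarrow> bool" where
  "solves_ode F u I \<longleftrightarrow> (\<forall>t\<in>I. (u has_vector_derivative F (u t)) (at t within I))"

text \<open>
  The state reached from \<^term>\<open>x\<close> after time \<^term>\<open>t\<close>; negative \<^term>\<open>t\<close> means backward evolution.
  The description is well defined when \<^term>\<open>F\<close> is locally Lipschitz and the solution through
  \<^term>\<open>x\<close> exists up to time \<^term>\<open>t\<close>.
\<close>

definition evolve :: "('a::real_normed_vector \<Rightarrow> 'a) \<Rightarrow> real \<Rightarrow> 'a \<Rightarrow> 'a" where
  "evolve F t x = (THE y. \<exists>u. solves_ode F u (closed_segment 0 t) \<and> u 0 = x \<and> u t = y)"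

text \<open>
  The existential form also guarantees that solutions starting near the set do not blow up; for
  locally Lipschitz \<^term>\<open>F\<close> the solution is unique, so that it agrees with the universal form.
\<close>

definition asymptotically_stable :: "('a::real_normed_vector \<Rightarrow> 'a) \<Rightarrow> 'a set \<Rightarrow> bool" where
  "asymptotically_stable F A \<longleftrightarrow>
     (\<forall>\<epsilon>>0. \<exists>\<delta>>0. \<forall>x. infdist x A < \<delta> \<longrightarrow>
        (\<exists>u. solves_ode F u {0..} \<and> u 0 = x \<and> (\<forall>t\<ge>0. infdist (u t) A < \<epsilon>))) \<and>
     (\<exists>\<delta>>0. \<forall>x. infdist x A < \<delta> \<longrightarrow>
        (\<exists>u. solves_ode F u {0..} \<and> u 0 = x \<and> ((\<lambda>t. infdist (u t) A) \<longlongrightarrow> 0) at_top))"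

definition periodic_orbit :: "('a::real_normed_vector \<Rightarrow> 'a) \<Rightarrow> 'a set \<Rightarrow> bool" where
  "periodic_orbit F \<Gamma> \<longleftrightarrow>
     (\<exists>u T. T > 0 \<and> solves_ode F u UNIV \<and> (\<forall>t. u (t + T) = u t) \<and>
            inj_on u {0..<T} \<and> \<Gamma> = range u)"

section \<open>Hausdorff distance and reach\<close>

text \<open>
  The real-valued suprema and infima are meaningful only for nonempty bounded sets.
\<close>

definition hausdorff_dist :: "'a::metric_space set \<Rightarrow> 'a set \<Rightarrow> real" where
  "hausdorff_dist A B = max (SUP a\<in>A. infdist a B) (SUP b\<in>B. infdist b A)"

definition reach :: "'a::metric_space set \<Rightarrow> ennreal" where
  "reach K =
     (SUP r \<in> {r::real. r > 0 \<and>
                 (\<forall>x. infdist x K < r \<longrightarrow> (\<exists>!y. y \<in> K \<and> dist x y = infdist x K))}.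
        ennreal r)"

section \<open>Supercritical Hopf bifurcation\<close>

definition partial_deriv :: "'n::finite \<Rightarrow> (real^'n \<Rightarrow> real^'n) \<Rightarrow> real^'n \<Rightarrow> real^'n" where
  "partial_deriv j F x = frechet_derivative F (at x) (axis j 1)"

definition complex_matrix :: "real^'n^'n \<Rightarrow> complex^'n^'n" where
  "complex_matrix A = map_matrix complex_of_real A"

definition complex_eigenvalue :: "real^'n^'n \<Rightarrow> complex \<Rightarrow> bool" where
  "complex_eigenvalue A z \<longleftrightarrow> (\<exists>v. v \<noteq> 0 \<and> complex_matrix A *v v = z *s v)"

text \<open>Conjugate-linear in the first argument.\<close>

definition cinner :: "complex^'n \<Rightarrow> complex^'n \<Rightarrow> complex" where
  "cinner p v = (\<Sum>i\<in>UNIV. cnj (p $ i) * v $ i)"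

definition vec_cnj :: "complex^'n \<Rightarrow> complex^'n" where
  "vec_cnj v = (\<chi> i. cnj (v $ i))"

text \<open>The complexified second and third derivatives of \<^term>\<open>F\<close> at \<^term>\<open>x\<close>.\<close>

definition second_form ::
  "(real^'n \<Rightarrow> real^'n) \<Rightarrow> real^'n \<Rightarrow> complex^'n \<Rightarrow> complex^'n \<Rightarrow> complex^'n" where
  "second_form F x u v =
     (\<chi> i. \<Sum>j\<in>UNIV. \<Sum>k\<in>UNIV.
        complex_of_real (partial_deriv j (partial_deriv k F) x $ i) * u $ j * v $ k)"

definition third_form ::
  "(real^'n \<Rightarrow> real^'n) \<Rightarrow> real^'n \<Rightarrow> complex^'n \<Rightarrow> complex^'n \<Rightarrow> complex^'n \<Rightarrow> complex^'n" where
  "third_form F x u v w =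
     (\<chi> i. \<Sum>j\<in>UNIV. \<Sum>k\<in>UNIV. \<Sum>l\<in>UNIV.
        complex_of_real (partial_deriv j (partial_deriv k (partial_deriv l F)) x $ i)
          * u $ j * v $ k * w $ l)"

text \<open>
  Kuznetsov's invariant formula for the first Lyapunov coefficient at an equilibrium with critical
  eigenvalues \<^term>\<open>\<i> * complex_of_real \<omega>\<close> and its conjugate, where \<^term>\<open>q\<close> is a critical
  eigenvector and \<^term>\<open>p\<close> the adjoint eigenvector, normalized as in \<open>hopf_eigenvectors\<close>.
\<close>

definition hopf_eigenvectors ::
  "real^'n^'n \<Rightarrow> real \<Rightarrow> complex^'n \<Rightarrow> complex^'n \<Rightarrow> bool" where
  "hopf_eigenvectors A \<omega> q p \<longleftrightarrow>
     complex_matrix A *v q = (\<i> * complex_of_real \<omega>) *s q \<and>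
     complex_matrix (transpose A) *v p = (- \<i> * complex_of_real \<omega>) *s p \<and>
     cinner q q = 1 \<and> cinner p q = 1"

definition first_lyapunov_coefficient ::
  "(real^'n \<Rightarrow> real^'n) \<Rightarrow> real^'n \<Rightarrow> real \<Rightarrow> complex^'n \<Rightarrow> complex^'n \<Rightarrow> real" where
  "first_lyapunov_coefficient F x \<omega> q p =
     (let A = complex_matrix (jacobian F (at x));
          B = second_form F x;
          C = third_form F x;
          q' = vec_cnj q
      in 1 / (2 * \<omega>) *
         Re (cinner p (C q q q')
             - 2 * cinner p (B q (matrix_inv A *v B q q'))
             + cinner p (B q' (matrix_inv (mat (2 * \<i> * complex_of_real \<omega>) - A) *v B q q))))"

text \<open>
  A simple pair of eigenvalues crosses the imaginary axis transversally at \<^term>\<open>\<mu>c\<close>, from left to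
  right, no other eigenvalue lies on the axis, and the first Lyapunov coefficient is negative.
  Simplicity is stated as nonvanishing of the derivative of the characteristic polynomial.  As the
  Jacobian is real, the conjugate of \<open>ev \<mu>\<close> is an eigenvalue as well.
\<close>

definition hopf_conditions ::
  "(real^'n \<Rightarrow> real \<Rightarrow> real^'n) \<Rightarrow> real \<Rightarrow> (real \<Rightarrow> real^'n) \<Rightarrow> bool" where
  "hopf_conditions f \<mu>c xs \<longleftrightarrow>
     (let Jac = (\<lambda>\<mu>. jacobian (\<lambda>x. f x \<mu>) (at (xs \<mu>))) in
      \<exists>\<omega> ev ev' q p.
        \<omega> > 0 \<and> ev \<mu>c = \<i> * complex_of_real \<omega> \<and>
        (\<forall>\<^sub>F \<mu> in nhds \<mu>c. complex_eigenvalue (Jac \<mu>) (ev \<mu>)) \<and>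
        (ev has_vector_derivative ev') (at \<mu>c) \<and> Re ev' > 0 \<and>
        deriv (\<lambda>z. det (mat z - complex_matrix (Jac \<mu>c))) (\<i> * complex_of_real \<omega>) \<noteq> 0 \<and>
        (\<forall>z. complex_eigenvalue (Jac \<mu>c) z \<and> Re z = 0 \<longrightarrow>
             z = \<i> * complex_of_real \<omega> \<or> z = - \<i> * complex_of_real \<omega>) \<and>
        hopf_eigenvectors (Jac \<mu>c) \<omega> q p \<and>
        first_lyapunov_coefficient (\<lambda>x. f x \<mu>c) (xs \<mu>c) \<omega> q p < 0)"

text \<open>
  \<^term>\<open>xs\<close> is the branch of equilibria over the parameter neighbourhood \<^term>\<open>J\<close> of \<^term>\<open>\<mu>c\<close>, and
  \<^term>\<open>\<Gamma>\<close> the branch of stable periodic orbits that bifurcates from it.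
\<close>

definition supercritical_hopf ::
  "(real^'n \<Rightarrow> real \<Rightarrow> real^'n) \<Rightarrow> real \<Rightarrow> real set \<Rightarrow> (real \<Rightarrow> real^'n) \<Rightarrow>
   (real \<Rightarrow> (real^'n) set) \<Rightarrow> bool" where
  "supercritical_hopf f \<mu>c J xs \<Gamma> \<longleftrightarrow>
     open J \<and> \<mu>c \<in> J \<and>
     smooth_on (UNIV \<times> J) (\<lambda>(x, \<mu>). f x \<mu>) \<and>
     continuous_on J xs \<and> (\<forall>\<mu>\<in>J. f (xs \<mu>) \<mu> = 0) \<and>
     hopf_conditions f \<mu>c xs \<and>
     (\<forall>\<mu>\<in>J. \<mu> < \<mu>c \<longrightarrow> asymptotically_stable (\<lambda>x. f x \<mu>) {xs \<mu>}) \<and>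
     (\<forall>\<mu>\<in>J. \<mu> > \<mu>c \<longrightarrow>
        periodic_orbit (\<lambda>x. f x \<mu>) (\<Gamma> \<mu>) \<and> asymptotically_stable (\<lambda>x. f x \<mu>) (\<Gamma> \<mu>)) \<and>
     ((\<lambda>\<mu>. hausdorff_dist (\<Gamma> \<mu>) {xs \<mu>c}) \<longlongrightarrow> 0) (at_right \<mu>c)"

text \<open>Used only for \<^prop>\<open>\<mu> \<noteq> \<mu>c\<close>.\<close>

definition attracting_set ::
  "real \<Rightarrow> (real \<Rightarrow> 'a) \<Rightarrow> (real \<Rightarrow> 'a set) \<Rightarrow> real \<Rightarrow> 'a set" where
  "attracting_set \<mu>c xs \<Gamma> \<mu> = (if \<mu> < \<mu>c then {xs \<mu>} else \<Gamma> \<mu>)"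

section \<open>Delay coordinates\<close>

text \<open>
  The linear order on the finite index type enumerates the coordinates: the index with
  \<open>k\<close> predecessors carries the observation delayed by \<open>k * \<tau>\<close>, for \<open>k = 0, \<dots>, m - 1\<close>.
\<close>

definition delay_map ::
  "('a::real_normed_vector \<Rightarrow> 'a) \<Rightarrow> ('a \<Rightarrow> real) \<Rightarrow> real \<Rightarrow> 'a \<Rightarrow> real^'m::{finite,linorder}" where
  "delay_map F h \<tau> x = (\<chi> i. h (evolve F (- (real (card {j. j < i}) * \<tau>)) x))"

text \<open>For an embedded submanifold this is its tangent space; for a point it is \<^term>\<open>{0}\<close>.\<close>

definition tangent_vectors :: "'a::real_normed_vector set \<Rightarrow> 'a \<Rightarrow> 'a set" where
  "tangent_vectors A x =
     {v. \<exists>c. c 0 = x \<and> (c has_vector_derivative v) (at 0) \<and> (\<forall>\<^sub>F t in nhds (0::real). c t \<in> A)}"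

text \<open>
  An injective immersion of the compact submanifold \<^term>\<open>A\<close>, of class \<open>C\<^sup>1\<close> in the sense that it
  extends to a \<open>C\<^sup>1\<close> map around \<^term>\<open>A\<close>.  By compactness it is a homeomorphism onto its image.
\<close>

definition embedding_on ::
  "'a::euclidean_space set \<Rightarrow> ('a \<Rightarrow> 'b::euclidean_space) \<Rightarrow> bool" where
  "embedding_on A \<Phi> \<longleftrightarrow>
     inj_on \<Phi> A \<and>
     (\<exists>U g. open U \<and> A \<subseteq> U \<and> Ck_on 1 U g \<and> (\<forall>x\<in>A. g x = \<Phi> x) \<and>
        (\<forall>x\<in>A. \<forall>v\<in>tangent_vectors A x. v \<noteq> 0 \<longrightarrow> frechet_derivative g (at x) v \<noteq> 0))"

section \<open>Vietoris--Rips persistence over the field with two elements\<close>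

definition vietoris_rips :: "'a::metric_space set \<Rightarrow> real \<Rightarrow> 'a set set" where
  "vietoris_rips Y \<epsilon> =
     {\<sigma>. \<sigma> \<noteq> {} \<and> finite \<sigma> \<and> \<sigma> \<subseteq> Y \<and> (\<forall>x\<in>\<sigma>. \<forall>y\<in>\<sigma>. dist x y \<le> \<epsilon>)}"

type_synonym 'a chain = "'a set \<Rightarrow>\<^sub>0 bit"

definition chain_scale :: "bit \<Rightarrow> 'a chain \<Rightarrow> 'a chain" where
  "chain_scale a c = Poly_Mapping.map ((*) a) c"

lemma lookup_chain_scale: "Poly_Mapping.lookup (chain_scale a c) \<sigma> = a * Poly_Mapping.lookup c \<sigma>"
  by (auto simp: chain_scale_def Poly_Mapping.map.rep_eq when_def)

global_interpretation chain: vector_space "chain_scale :: bit \<Rightarrow> 'a chain \<Rightarrow> 'a chain"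
  by unfold_locales
     (auto intro!: poly_mapping_eqI simp: lookup_chain_scale lookup_add distrib_left distrib_right
       mult.assoc)

definition chains :: "nat \<Rightarrow> 'a set set \<Rightarrow> 'a chain set" where
  "chains p K = {c. Poly_Mapping.keys c \<subseteq> {\<sigma>\<in>K. card \<sigma> = p + 1}}"

text \<open>Discarding the empty face makes the boundary of a vertex zero (unreduced homology).\<close>

definition boundary :: "'a chain \<Rightarrow> 'a chain" where
  "boundary c =
     (\<Sum>\<sigma>\<in>Poly_Mapping.keys c. \<Sum>x | x \<in> \<sigma> \<and> \<sigma> - {x} \<noteq> {}. Poly_Mapping.single (\<sigma> - {x}) 1)"

definition cycles :: "nat \<Rightarrow> 'a set set \<Rightarrow> 'a chain set" where
  "cycles p K = {c \<in> chains p K. boundary c = 0}"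

definition boundaries :: "nat \<Rightarrow> 'a set set \<Rightarrow> 'a chain set" where
  "boundaries p K = boundary ` chains (p + 1) K"

text \<open>
  For finite complexes \<^prop>\<open>K \<subseteq> L\<close>: the rank of the map \<open>H\<^sub>p(K) \<rightarrow> H\<^sub>p(L)\<close> induced by inclusion,
  whose image is \<open>Z\<^sub>p(K) / (Z\<^sub>p(K) \<inter> B\<^sub>p(L))\<close>.
\<close>

definition persistent_betti :: "nat \<Rightarrow> 'a set set \<Rightarrow> 'a set set \<Rightarrow> nat" where
  "persistent_betti p K L = chain.dim (cycles p K) - chain.dim (cycles p K \<inter> boundaries p L)"

abbreviation vr_betti :: "nat \<Rightarrow> 'a::metric_space set \<Rightarrow> real \<Rightarrow> real \<Rightarrow> nat" where
  "vr_betti p Y s t \<equiv> persistent_betti p (vietoris_rips Y s) (vietoris_rips Y t)"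

text \<open>
  The number of classes born at \<^term>\<open>b\<close> and dying at \<^term>\<open>d\<close>, by inclusion--exclusion on persistent
  Betti numbers.  For finite \<^term>\<open>Y\<close> the expression is constant for all small \<^prop>\<open>\<epsilon> > 0\<close>.
  The complex is empty at negative scales, which covers \<^prop>\<open>b = 0\<close>.
\<close>

definition persistence_multiplicity :: "nat \<Rightarrow> 'a::metric_space set \<Rightarrow> real \<Rightarrow> real \<Rightarrow> nat" where
  "persistence_multiplicity p Y b d =
     nat (THE k. \<forall>\<^sub>F \<epsilon> in at_right 0.
       (int (vr_betti p Y (b + \<epsilon>) (d - \<epsilon>)) - int (vr_betti p Y (b - \<epsilon>) (d - \<epsilon>)))
       - (int (vr_betti p Y (b + \<epsilon>) (d + \<epsilon>)) - int (vr_betti p Y (b - \<epsilon>) (d + \<epsilon>))) = k)"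

text \<open>
  The off-diagonal part of the diagram of a finite \<^term>\<open>Y\<close>.  For \<^prop>\<open>p \<ge> 1\<close> every class dies at
  a finite scale, because the complex is a full simplex at large scales.
\<close>

definition persistence_diagram :: "nat \<Rightarrow> 'a::metric_space set \<Rightarrow> (real \<times> real) multiset" where
  "persistence_diagram p Y =
     Abs_multiset (\<lambda>(b, d). if b < d then persistence_multiplicity p Y b d else 0)"

definition max_persistence :: "'a::metric_space set \<Rightarrow> real" where
  "max_persistence Y =
     (let D = persistence_diagram 1 Y
      in if D = {#} then 0 else Max ((\<lambda>(b, d). d - b) ` set_mset D))"

end

theory Submission
  imports Defs
begin

text \<open>
  Below the bifurcation the cloud lies in a ball of radius \<open>q\<close>, so its diameter is at most \<open>2q\<close>, and no bar
  of a Vietoris--Rips filtration is longer than the diameter of the cloud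
  (\<open>persistence_le_diameter\<close>).

  Above the bifurcation \<open>M\<close> is a simple closed curve of reach \<open>R\<close>, and one loop that follows it has to be
  shown to live long.  The obstruction to filling the loop is its winding number.  A point at distance less
  than \<open>R\<close> from \<open>M\<close> has a unique nearest point on \<open>M\<close>, which depends continuously on it; followed by the
  angle on the curve this gives a circle-valued map on the open \<open>R\<close>-neighbourhood of \<open>M\<close>.  A subset of \<open>M\<close> of
  diameter less than \<open>\<surd>2 * R\<close> has its convex hull inside that neighbourhood
  (\<open>convex_hull_near_vertex\<close>), and there the angle lifts to the reals.  Hence short edges between points
  of \<open>M\<close> carry integers that add up to zero around every short triangle and to one around the curve
  (\<open>integer_cocycle_of_circle_map\<close>).

  A cloud \<open>X\<close> that is \<open>(\<delta> + q)\<close>-dense along \<open>M\<close> and \<open>q\<close>-close to it carries a polygon with edges barely longer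
  than \<open>2(\<delta> + q)\<close>.  Moving the points of \<open>X\<close> back to \<open>M\<close> changes distances by at most \<open>2q\<close>, so up to
  scale \<open>\<surd>2 * R - 2q\<close> the cocycle pulls back to \<open>X\<close>, where modulo two it kills boundaries but not the
  polygon (\<open>sampled_closed_curve_diagram_point\<close>).  A cycle that survives from one scale to another
  produces a bar over that range (\<open>persistent_cycle_yields_diagram_point\<close>), and the constant
  \<open>2 * \<surd>(3/10) < 1.1\<close> of the theorem leaves room to spare.
\<close>

section \<open>Chains over the field with two elements\<close>

text \<open>
  A chain over \<^typ>\<open>bit\<close> is determined by its support, so a function on simplices with values in a
  group of exponent two extends to chains by summing over the support.  The boundary operator, the
  cone operator and the evaluation of a cochain all have this form.
\<close>

definition extend_linearly :: "('a set \<Rightarrow> 'b::comm_monoid_add) \<Rightarrow> 'a chain \<Rightarrow> 'b" where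
  "extend_linearly g c = (\<Sum>\<sigma>\<in>Poly_Mapping.keys c. g \<sigma>)"

lemma extend_linearly_zero [simp]: "extend_linearly g 0 = 0"
  by (simp add: extend_linearly_def)

lemma extend_linearly_single [simp]: "extend_linearly g (Poly_Mapping.single \<sigma> 1) = g \<sigma>"
  by (simp add: extend_linearly_def)

text \<open>
  Exponent two is what makes the extension additive: a simplex in both supports leaves the support of
  the sum, and its two contributions cancel.
\<close>

lemma extend_linearly_add:
  fixes g :: "'a set \<Rightarrow> 'b::comm_monoid_add"
  assumes char2: "\<And>x::'b. x + x = 0"
  shows "extend_linearly g (a + b) = extend_linearly g a + extend_linearly g b"
proof -
  let ?S = "Poly_Mapping.keys a \<union> Poly_Mapping.keys b"
  let ?g = "\<lambda>c \<sigma>. if Poly_Mapping.lookup c \<sigma> = 1 then g \<sigma> else 0"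
  have superset: "extend_linearly g c = (\<Sum>\<sigma>\<in>?S. ?g c \<sigma>)" if "Poly_Mapping.keys c \<subseteq> ?S" for c
  proof -
    have "Poly_Mapping.keys c = {\<sigma>\<in>?S. Poly_Mapping.lookup c \<sigma> = 1}"
      using that by (auto simp: in_keys_iff)
    then show ?thesis
      unfolding extend_linearly_def by (simp only: sum.inter_filter finite_Un finite_keys simp_thms)
  qed
  have "?g (a + b) \<sigma> = ?g a \<sigma> + ?g b \<sigma>" for \<sigma>
    by (cases "Poly_Mapping.lookup a \<sigma>"; cases "Poly_Mapping.lookup b \<sigma>")
       (auto simp: lookup_add char2)
  then show ?thesis
    using Poly_Mapping.keys_add[of a b] by (simp add: superset sum.distrib)
qed

lemma extend_linearly_sum:
  fixes g :: "'a set \<Rightarrow> 'b::comm_monoid_add"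
  assumes "\<And>x::'b. x + x = 0"
  shows "extend_linearly g (\<Sum>i\<in>I. c i) = (\<Sum>i\<in>I. extend_linearly g (c i))"
  by (induction I rule: infinite_finite_induct) (simp_all add: extend_linearly_add[OF assms])

lemma chain_add_self: "c + c = (0 :: 'a chain)"
  by (rule poly_mapping_eqI) (simp add: lookup_add)

lemma bit_add_self: "x + x = (0 :: bit)"
  by (cases x) simp_all

lemma chain_eq_sum_keys: "c = (\<Sum>\<sigma>\<in>Poly_Mapping.keys c. Poly_Mapping.single \<sigma> (1::bit))"
proof (rule poly_mapping_eqI)
  fix \<tau>
  have "Poly_Mapping.lookup (\<Sum>\<sigma>\<in>Poly_Mapping.keys c. Poly_Mapping.single \<sigma> (1::bit)) \<tau>
        = (\<Sum>\<sigma>\<in>Poly_Mapping.keys c. if \<sigma> = \<tau> then 1 else 0)"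
    by (simp add: lookup_sum lookup_single when_def)
  also have "\<dots> = Poly_Mapping.lookup c \<tau>" by (simp add: in_keys_iff)
  finally show "Poly_Mapping.lookup c \<tau>
    = Poly_Mapping.lookup (\<Sum>\<sigma>\<in>Poly_Mapping.keys c. Poly_Mapping.single \<sigma> (1::bit)) \<tau>" by simp
qed

definition facet_sum :: "'a set \<Rightarrow> 'a chain" where
  "facet_sum \<sigma> = (\<Sum>x | x \<in> \<sigma> \<and> \<sigma> - {x} \<noteq> {}. Poly_Mapping.single (\<sigma> - {x}) 1)"

lemma boundary_eq_extend_linearly: "boundary = extend_linearly facet_sum"
  by (simp add: fun_eq_iff boundary_def extend_linearly_def facet_sum_def)

lemma boundary_add: "boundary (a + b) = boundary a + boundary b"
  by (simp add: boundary_eq_extend_linearly extend_linearly_add chain_add_self)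

lemma boundary_sum: "boundary (\<Sum>i\<in>I. c i) = (\<Sum>i\<in>I. boundary (c i))"
  by (simp add: boundary_eq_extend_linearly extend_linearly_sum chain_add_self)

lemma boundary_single: "boundary (Poly_Mapping.single \<sigma> 1) = facet_sum \<sigma>"
  by (simp add: boundary_eq_extend_linearly)

lemma facet_sum_edge:
  assumes "x \<noteq> y"
  shows "facet_sum {x, y} = Poly_Mapping.single {x} 1 + Poly_Mapping.single {y} 1"
proof -
  have "{v. v \<in> {x, y} \<and> {x, y} - {v} \<noteq> {}} = {x, y}" "{x, y} - {x} = {y}" "{x, y} - {y} = {x}"
    using assms by auto
  then show ?thesis using assms by (simp add: facet_sum_def add.commute)
qed

lemma chains_add: "a \<in> chains p K \<Longrightarrow> b \<in> chains p K \<Longrightarrow> a + b \<in> chains p K"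
  using Poly_Mapping.keys_add[of a b] by (auto simp: chains_def)

lemma chains_sum: "(\<And>i. i \<in> I \<Longrightarrow> c i \<in> chains p K) \<Longrightarrow> (\<Sum>i\<in>I. c i) \<in> chains p K"
  by (induction I rule: infinite_finite_induct) (auto simp: chains_add, auto simp: chains_def)

lemma cycles_mono: "K \<subseteq> L \<Longrightarrow> cycles p K \<subseteq> cycles p L"
  by (auto simp: cycles_def chains_def)

lemma boundaries_mono: "K \<subseteq> L \<Longrightarrow> boundaries p K \<subseteq> boundaries p L"
  by (force simp: boundaries_def chains_def)

lemma subspace_boundaries: "chain.subspace (boundaries p K)"
proof (unfold chain.subspace_def, intro conjI ballI allI)
  show "0 \<in> boundaries p K"
    unfolding boundaries_def by (rule image_eqI[of _ _ 0]) (auto simp: boundary_def chains_def)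
next
  fix a b assume "a \<in> boundaries p K" "b \<in> boundaries p K"
  then show "a + b \<in> boundaries p K"
    unfolding boundaries_def by (auto simp flip: boundary_add intro!: imageI chains_add)
next
  fix a :: bit and c assume "c \<in> boundaries p K"
  moreover have "0 \<in> boundaries p K"
    unfolding boundaries_def by (rule image_eqI[of _ _ 0]) (auto simp: boundary_def chains_def)
  ultimately show "chain_scale a c \<in> boundaries p K"
    by (cases a) auto
qed

text \<open>
  Joining every simplex to an apex \<open>v\<close> is a contracting homotopy: on each simplex of positive
  dimension, the boundary of the cone plus the cone over the boundary is the simplex itself.  Hence a
  cycle bounds in any complex that contains the cone over the one it lives in.  At the scale of the
  diameter the Vietoris--Rips complex is a full simplex, hence a cone; so every class dies by then.
\<close>

lemma cycle_is_boundary_of_cone: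
  assumes p: "p \<ge> 1" and c: "c \<in> cycles p K"
    and cone: "\<And>\<sigma>. \<sigma> \<in> K \<Longrightarrow> insert v \<sigma> \<in> L"
  shows "c \<in> boundaries p L"
proof -
  define cn :: "'a set \<Rightarrow> 'a chain" where
    "cn \<sigma> = (if v \<in> \<sigma> then 0 else Poly_Mapping.single (insert v \<sigma>) 1)" for \<sigma>
  note lin = extend_linearly_sum[OF chain_add_self] extend_linearly_add[OF chain_add_self]
  have keys: "\<sigma> \<in> K" "card \<sigma> = p + 1" if "\<sigma> \<in> Poly_Mapping.keys c" for \<sigma>
    using c that by (auto simp: cycles_def chains_def)
  have htpy: "boundary (cn \<sigma>) + extend_linearly cn (facet_sum \<sigma>) = Poly_Mapping.single \<sigma> 1"
    if "\<sigma> \<in> Poly_Mapping.keys c" for \<sigma>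
  proof -
    have fin: "finite \<sigma>" using keys(2)[OF that] by (intro card_ge_0_finite) simp
    have facets: "\<sigma> - {x} \<noteq> {}" for x
    proof
      assume "\<sigma> - {x} = {}"
      then have "card \<sigma> \<le> card {x}" by (intro card_mono) auto
      then show False using keys(2)[OF that] p by simp
    qed
    have fs: "facet_sum \<sigma> = (\<Sum>x\<in>\<sigma>. Poly_Mapping.single (\<sigma> - {x}) 1)"
      unfolding facet_sum_def using facets by (intro sum.cong) auto
    show ?thesis
    proof (cases "v \<in> \<sigma>")
      case False
      have "facet_sum (insert v \<sigma>) = (\<Sum>x\<in>insert v \<sigma>. Poly_Mapping.single (insert v \<sigma> - {x}) 1)"
        unfolding facet_sum_def using facets False by (intro sum.cong) auto
      also have "\<dots> = Poly_Mapping.single \<sigma> 1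
                    + (\<Sum>x\<in>\<sigma>. Poly_Mapping.single (insert v \<sigma> - {x}) 1)"
        using False fin by simp
      also have "(\<Sum>x\<in>\<sigma>. Poly_Mapping.single (insert v \<sigma> - {x}) (1::bit))
               = (\<Sum>x\<in>\<sigma>. cn (\<sigma> - {x}))"
      proof (rule sum.cong[OF refl])
        fix x assume "x \<in> \<sigma>"
        then have "insert v \<sigma> - {x} = insert v (\<sigma> - {x})" using False by auto
        then show "Poly_Mapping.single (insert v \<sigma> - {x}) (1::bit) = cn (\<sigma> - {x})"
          using False by (simp add: cn_def)
      qed
      finally show ?thesis
        using False by (simp add: cn_def[of \<sigma>] boundary_single fs lin add.assoc chain_add_self)
    next
      case True
      have "(\<Sum>x\<in>\<sigma>. cn (\<sigma> - {x})) = (\<Sum>x\<in>\<sigma>. if x = v then Poly_Mapping.single \<sigma> 1 else 0)"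
        using True by (intro sum.cong) (auto simp: cn_def insert_absorb)
      also have "\<dots> = Poly_Mapping.single \<sigma> 1" using True fin by simp
      finally show ?thesis
        using True by (simp add: cn_def[of \<sigma>] fs lin boundary_eq_extend_linearly)
    qed
  qed
  have "boundary (extend_linearly cn c)
      = (\<Sum>\<sigma>\<in>Poly_Mapping.keys c. boundary (cn \<sigma>))"
    by (simp add: extend_linearly_def[of cn] boundary_sum)
  moreover have "extend_linearly cn (boundary c)
      = (\<Sum>\<sigma>\<in>Poly_Mapping.keys c. extend_linearly cn (facet_sum \<sigma>))"
    by (simp add: boundary_eq_extend_linearly extend_linearly_def[of facet_sum] lin)
  moreover have "boundary c = 0" using c by (simp add: cycles_def)
  ultimately have "boundary (extend_linearly cn c)
      = (\<Sum>\<sigma>\<in>Poly_Mapping.keys c. boundary (cn \<sigma>) + extend_linearly cn (facet_sum \<sigma>))"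
    by (simp add: sum.distrib)
  also have "\<dots> = c" using htpy by (simp flip: chain_eq_sum_keys)
  finally have "boundary (extend_linearly cn c) = c" .
  moreover have "extend_linearly cn c \<in> chains (p + 1) L"
    unfolding extend_linearly_def
  proof (rule chains_sum)
    fix \<sigma> assume \<sigma>: "\<sigma> \<in> Poly_Mapping.keys c"
    have "finite \<sigma>" using keys(2)[OF \<sigma>] by (intro card_ge_0_finite) simp
    then show "cn \<sigma> \<in> chains (p + 1) L"
      using keys[OF \<sigma>] cone by (auto simp: cn_def chains_def)
  qed
  ultimately show ?thesis unfolding boundaries_def by force
qed

lemma persistent_betti_eq_0:
  assumes "cycles p K \<subseteq> boundaries p L"
  shows "persistent_betti p K L = 0"
  using assms by (simp add: persistent_betti_def Int_absorb2)

text \<open>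
  A cycle outside the subspace of boundaries enlarges a basis of the intersection to an independent
  set of cycles; finiteness of the complex turns this into a strict inequality of dimensions.
\<close>

lemma persistent_betti_pos:
  assumes "finite K" and c: "c \<in> cycles p K" "c \<notin> boundaries p L"
  shows "persistent_betti p K L > 0"
proof -
  let ?Z = "cycles p K" and ?T = "(\<lambda>\<sigma>. Poly_Mapping.single \<sigma> (1::bit)) ` K"
  have spanning: "?Z \<subseteq> chain.span ?T"
  proof
    fix z assume z: "z \<in> ?Z"
    have "(\<Sum>\<sigma>\<in>Poly_Mapping.keys z. Poly_Mapping.single \<sigma> (1::bit)) \<in> chain.span ?T"
      using z by (intro chain.span_sum chain.span_base) (auto simp: cycles_def chains_def)
    then show "z \<in> chain.span ?T" by (subst chain_eq_sum_keys)
  qed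
  have fin: "finite B" if "chain.independent B" "B \<subseteq> ?Z" for B
    using chain.independent_span_bound[OF finite_imageI[OF \<open>finite K\<close>] that(1)] that(2) spanning
    by blast
  obtain B where B: "B \<subseteq> ?Z \<inter> boundaries p L" "chain.independent B"
      "card B = chain.dim (?Z \<inter> boundaries p L)"
    by (rule chain.basis_exists[of "?Z \<inter> boundaries p L"])
  have "chain.span B \<subseteq> boundaries p L"
    using B(1) subspace_boundaries by (intro chain.span_minimal) auto
  then have "c \<notin> chain.span B" using c(2) by blast
  then have "chain.independent (insert c B)" "c \<notin> B"
    using B(2) chain.independent_insertI chain.span_base by blast+
  moreover have "insert c B \<subseteq> ?Z" using c B by auto
  ultimately obtain B' where B': "insert c B \<subseteq> B'" "B' \<subseteq> ?Z" "chain.independent B'"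
      "?Z \<subseteq> chain.span B'"
    using chain.maximal_independent_subset_extend by metis
  have "card B' = chain.dim ?Z" using B' by (intro chain.basis_card_eq_dim) auto
  moreover have "card B < card (insert c B)" using \<open>c \<notin> B\<close> fin[OF B(2)] B(1) by simp
  moreover have "card (insert c B) \<le> card B'" using B' fin by (intro card_mono) auto
  ultimately show ?thesis using B(3) by (simp add: persistent_betti_def)
qed

section \<open>Persistence diagrams\<close>

text \<open>
  The critical scales: the Vietoris--Rips complex can change only at a distance between two points.
\<close>

definition distances :: "'a::metric_space set \<Rightarrow> real set" where
  "distances Y = (\<lambda>(x, y). dist x y) ` (Y \<times> Y)"

lemma finite_distances: "finite Y \<Longrightarrow> finite (distances Y)"
  by (simp add: distances_def)

lemma dist_in_distances: "x \<in> Y \<Longrightarrow> y \<in> Y \<Longrightarrow> dist x y \<in> distances Y"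
  by (force simp: distances_def)

lemma finite_vietoris_rips: "finite Y \<Longrightarrow> finite (vietoris_rips Y r)"
  by (rule finite_subset[of _ "Pow Y"]) (auto simp: vietoris_rips_def)

lemma vietoris_rips_mono: "s \<le> t \<Longrightarrow> vietoris_rips Y s \<subseteq> vietoris_rips Y t"
  by (force simp: vietoris_rips_def)

lemma vietoris_rips_cong:
  assumes "\<And>r. r \<in> distances Y \<Longrightarrow> r \<le> s \<longleftrightarrow> r \<le> t"
  shows "vietoris_rips Y s = vietoris_rips Y t"
  unfolding vietoris_rips_def using assms dist_in_distances by blast

lemma vietoris_rips_round_down:
  assumes "finite Y"
  obtains "vietoris_rips Y s = {}"
  | r where "r \<in> distances Y" "r \<le> s" "vietoris_rips Y r = vietoris_rips Y s"
proof (cases "{r \<in> distances Y. r \<le> s} = {}")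
  case True
  have "\<not> (\<forall>x\<in>\<sigma>. \<forall>y\<in>\<sigma>. dist x y \<le> s)" if "\<sigma> \<noteq> {}" "\<sigma> \<subseteq> Y" for \<sigma>
    using True that dist_in_distances by blast
  then have "vietoris_rips Y s = {}" by (auto simp: vietoris_rips_def)
  then show ?thesis using that by blast
next
  case False
  let ?r = "Max {r \<in> distances Y. r \<le> s}"
  have fin: "finite {r \<in> distances Y. r \<le> s}" using finite_distances[OF assms] by simp
  then have "?r \<in> {r \<in> distances Y. r \<le> s}" using False by (rule Max_in)
  moreover have "vietoris_rips Y ?r = vietoris_rips Y s"
    using calculation fin by (intro vietoris_rips_cong) (auto intro!: Max_ge)
  ultimately show ?thesis using that by blast
qed

lemma eventually_vietoris_rips_right:
  assumes "finite Y"
  shows "\<forall>\<^sub>F \<epsilon> in at_right 0. vietoris_rips Y (b + \<epsilon>) = vietoris_rips Y b"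
proof -
  have "\<forall>\<^sub>F \<epsilon> in at_right 0. r \<le> b + \<epsilon> \<longleftrightarrow> r \<le> b" for r :: real
    unfolding eventually_at_right_field
    by (rule exI[of _ "if r \<le> b then 1 else r - b"]) auto
  then have "\<forall>\<^sub>F \<epsilon> in at_right 0. \<forall>r\<in>distances Y. r \<le> b + \<epsilon> \<longleftrightarrow> r \<le> b"
    using finite_distances[OF assms] by (simp add: eventually_ball_finite)
  then show ?thesis
    by (rule eventually_mono) (rule vietoris_rips_cong, blast)
qed

lemma eventually_vietoris_rips_left:
  assumes "finite Y" "b \<notin> distances Y"
  shows "\<forall>\<^sub>F \<epsilon> in at_right 0. vietoris_rips Y (b - \<epsilon>) = vietoris_rips Y b"
proof -
  have "\<forall>\<^sub>F \<epsilon> in at_right 0. r \<le> b - \<epsilon> \<longleftrightarrow> r \<le> b" if "r \<noteq> b" for r :: real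
    unfolding eventually_at_right_field
    using that by (intro exI[of _ "if r \<le> b then b - r else 1"]) auto
  then have "\<forall>\<^sub>F \<epsilon> in at_right 0. \<forall>r\<in>distances Y. r \<le> b - \<epsilon> \<longleftrightarrow> r \<le> b"
    using finite_distances[OF assms(1)] assms(2) by (intro eventually_ball_finite ballI) metis+
  then show ?thesis
    by (rule eventually_mono) (rule vietoris_rips_cong, blast)
qed

lemma persistence_multiplicity_eqI:
  assumes "\<forall>\<^sub>F \<epsilon> in at_right 0.
       (int (vr_betti p Y (b + \<epsilon>) (d - \<epsilon>)) - int (vr_betti p Y (b - \<epsilon>) (d - \<epsilon>)))
       - (int (vr_betti p Y (b + \<epsilon>) (d + \<epsilon>)) - int (vr_betti p Y (b - \<epsilon>) (d + \<epsilon>))) = k"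
  shows "persistence_multiplicity p Y b d = nat k"
proof -
  have unique: "j = k" if "\<forall>\<^sub>F \<epsilon> in at_right 0.
       (int (vr_betti p Y (b + \<epsilon>) (d - \<epsilon>)) - int (vr_betti p Y (b - \<epsilon>) (d - \<epsilon>)))
       - (int (vr_betti p Y (b + \<epsilon>) (d + \<epsilon>)) - int (vr_betti p Y (b - \<epsilon>) (d + \<epsilon>))) = j" for j
  proof -
    have "\<forall>\<^sub>F \<epsilon> in at_right (0::real). j = k"
      using that assms by eventually_elim simp
    then show ?thesis by (simp add: eventually_const_iff)
  qed
  show ?thesis
    unfolding persistence_multiplicity_def
    by (intro arg_cong[where f = nat] the_equality) (fact assms, erule unique)
qed

text \<open>
  At an endpoint that is not a distance the complex is locally constant in the scale, so the
  inclusion--exclusion terms cancel in pairs.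
\<close>

lemma persistence_multiplicity_nonzero:
  assumes "finite Y" "persistence_multiplicity p Y b d \<noteq> 0"
  shows "b \<in> distances Y" "d \<in> distances Y"
proof -
  have "persistence_multiplicity p Y b d = nat 0" if "b \<notin> distances Y"
    by (rule persistence_multiplicity_eqI)
       (use eventually_vietoris_rips_right[OF assms(1), of b]
          eventually_vietoris_rips_left[OF assms(1) that] in \<open>eventually_elim, simp\<close>)
  then show "b \<in> distances Y" using assms(2) by auto
  have "persistence_multiplicity p Y b d = nat 0" if "d \<notin> distances Y"
    by (rule persistence_multiplicity_eqI)
       (use eventually_vietoris_rips_right[OF assms(1), of d]
          eventually_vietoris_rips_left[OF assms(1) that] in \<open>eventually_elim, simp\<close>)
  then show "d \<in> distances Y" using assms(2) by auto
qed

lemma in_persistence_diagram_iff: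
  assumes "finite Y"
  shows "(b, d) \<in># persistence_diagram p Y \<longleftrightarrow> b < d \<and> persistence_multiplicity p Y b d \<noteq> 0"
proof -
  let ?m = "\<lambda>(b, d). if b < d then persistence_multiplicity p Y b d else 0"
  have "finite {x. ?m x > 0}"
  proof (rule finite_subset)
    show "{x. ?m x > 0} \<subseteq> distances Y \<times> distances Y"
      using persistence_multiplicity_nonzero[OF assms] by (auto split: if_splits)
    show "finite (distances Y \<times> distances Y)" using finite_distances[OF assms] by simp
  qed
  from count_Abs_multiset[OF this] have "count (persistence_diagram p Y) = ?m"
    by (simp add: persistence_diagram_def)
  then show ?thesis by (simp flip: count_greater_zero_iff)
qed

text \<open>
  Both endpoints of a bar are distances, so births are nonnegative and deaths at most the diameter.
\<close>

lemma persistence_le_diameter: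
  assumes "finite Y" and "\<And>x y. x \<in> Y \<Longrightarrow> y \<in> Y \<Longrightarrow> dist x y \<le> r"
    and "(b, d) \<in># persistence_diagram p Y"
  shows "d - b \<le> r"
proof -
  have "b \<in> distances Y" "d \<in> distances Y"
    using persistence_multiplicity_nonzero[OF assms(1)]
      assms(3)[unfolded in_persistence_diagram_iff[OF assms(1)]] by blast+
  then have "0 \<le> b" "d \<le> r" using assms(2) by (auto simp: distances_def)
  then show ?thesis by simp
qed

lemma max_persistence_le:
  assumes "0 \<le> r" and "\<And>b d. (b, d) \<in># persistence_diagram 1 Y \<Longrightarrow> d - b \<le> r"
  shows "max_persistence Y \<le> r"
proof (cases "persistence_diagram 1 Y = {#}")
  case False
  then show ?thesis
    unfolding max_persistence_def Let_def using assms(2) by (auto intro!: Max.boundedI)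
qed (use assms in \<open>simp add: max_persistence_def\<close>)

lemma max_persistence_ge:
  assumes "(b, d) \<in># persistence_diagram 1 Y"
  shows "d - b \<le> max_persistence Y"
  unfolding max_persistence_def Let_def using assms by (auto intro!: Max_ge)

lemma max_persistence_nonneg:
  assumes "finite Y"
  shows "0 \<le> max_persistence Y"
proof (cases "persistence_diagram 1 Y = {#}")
  case False
  then obtain b d where "(b, d) \<in># persistence_diagram 1 Y" by (metis multiset_nonemptyE surj_pair)
  then have "b < d" "d - b \<le> max_persistence Y"
    using in_persistence_diagram_iff[OF assms] max_persistence_ge by blast+
  then show ?thesis by simp
qed (simp add: max_persistence_def)

text \<open>
  A cycle that survives from scale \<open>s\<close> to scale \<open>t\<close> forces a bar over that range.  One takes \<open>b\<close> to be the
  first critical scale with a cycle surviving to \<open>t\<close>, and \<open>d\<close> the first critical scale at which all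
  cycles present at \<open>b\<close> bound.  This extremal choice makes three of the four persistent Betti numbers in
  the multiplicity of \<open>(b, d)\<close> vanish and the remaining one positive.
\<close>

lemma persistent_cycle_yields_diagram_point:
  assumes Y: "finite Y" and p: "p \<ge> 1" and "s \<le> t"
    and c: "c \<in> cycles p (vietoris_rips Y s)" "c \<notin> boundaries p (vietoris_rips Y t)"
  obtains b d where "(b, d) \<in># persistence_diagram p Y" "b \<le> s" "t < d"
proof -
  let ?Z = "\<lambda>r. cycles p (vietoris_rips Y r)" and ?B = "\<lambda>r. boundaries p (vietoris_rips Y r)"
  note fin = finite_distances[OF Y]
  have Z_mono: "?Z r \<subseteq> ?Z r'" and B_mono: "?B r \<subseteq> ?B r'" if "r \<le> r'" for r r'
    using that by (intro cycles_mono boundaries_mono vietoris_rips_mono; assumption)+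
  have Z_empty: "?Z r \<subseteq> ?B r'" if "vietoris_rips Y r = {}" for r r'
  proof -
    have "?Z r \<subseteq> {0}" using that by (auto simp: cycles_def chains_def)
    then show ?thesis using chain.subspace_0[OF subspace_boundaries] by blast
  qed

  define S where "S = {r \<in> distances Y. \<not> ?Z r \<subseteq> ?B t}"
  obtain r where r: "r \<in> S" "r \<le> s"
    using Y
  proof (cases rule: vietoris_rips_round_down[of Y s])
    case 1
    then show thesis using Z_empty c by blast
  next
    case (2 r)
    then show thesis using that[of r] c by (auto simp: S_def)
  qed
  define b where "b = Min S"
  have finS: "finite S" using fin by (simp add: S_def)
  have b: "b \<in> S" "b \<le> s" using r finS unfolding b_def by (auto intro: Min_in Min.coboundedI order_trans)
  have below_b: "?Z r \<subseteq> ?B t" if "r < b" for r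
    using Y
  proof (cases rule: vietoris_rips_round_down[of Y r])
    case (2 r')
    then have "r' \<notin> S" using that finS unfolding b_def by (metis Min_le leD order_le_less_trans)
    then show ?thesis using 2 by (auto simp: S_def)
  qed (rule Z_empty)

  define D where "D = {r \<in> distances Y. ?Z b \<subseteq> ?B r}"
  have finD: "finite D" using fin by (simp add: D_def)
  have "Y \<noteq> {}" using b(1) by (auto simp: S_def distances_def)
  then obtain v where v: "v \<in> Y" by blast
  have "Max (distances Y) \<in> D"
  proof -
    have mem: "Max (distances Y) \<in> distances Y" using fin dist_in_distances[OF v v] by (auto intro: Max_in)
    have "c' \<in> ?B (Max (distances Y))" if "c' \<in> ?Z b" for c'
    proof (rule cycle_is_boundary_of_cone[OF p that])
      fix \<sigma> assume "\<sigma> \<in> vietoris_rips Y b"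
      then have "finite (insert v \<sigma>)" "insert v \<sigma> \<subseteq> Y" using v by (auto simp: vietoris_rips_def)
      moreover have "dist x y \<le> Max (distances Y)" if "x \<in> Y" "y \<in> Y" for x y
        using fin dist_in_distances[OF that] by (rule Max_ge)
      ultimately show "insert v \<sigma> \<in> vietoris_rips Y (Max (distances Y))"
        unfolding vietoris_rips_def by blast
    qed
    then show ?thesis using mem by (auto simp: D_def)
  qed
  define d where "d = Min D"
  have d: "d \<in> D" unfolding d_def using finD \<open>Max (distances Y) \<in> D\<close> by (auto intro: Min_in)
  have below_d: "\<not> ?Z b \<subseteq> ?B r" if "r < d" for r
    using Y
  proof (cases rule: vietoris_rips_round_down[of Y r])
    case 1
    then have "?B r \<subseteq> ?B t" by (intro boundaries_mono) simp
    then show ?thesis using b(1) by (auto simp: S_def)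
  next
    case (2 r')
    then have "r' \<notin> D" using that finD unfolding d_def by (metis Min_le leD order_le_less_trans)
    then show ?thesis using 2 by (auto simp: D_def)
  qed
  have "t < d"
  proof (rule ccontr)
    assume "\<not> t < d"
    then have "?B d \<subseteq> ?B t" using B_mono[of d t] by simp
    then show False using b d by (auto simp: S_def D_def)
  qed

  define C where "C = insert ((t + d) / 2) {r \<in> distances Y. r < d}"
  define r where "r = Max C"
  have finC: "finite C" and "C \<noteq> {}" using fin by (simp_all add: C_def)
  then have "r \<in> C" unfolding r_def by (rule Max_in)
  have upper: "x \<le> r" if "x \<in> C" for x
    unfolding r_def using finC that by (rule Max_ge)
  have r: "t < r" "r < d"
    using \<open>t < d\<close> \<open>r \<in> C\<close> upper[of "(t + d) / 2"] by (auto simp: C_def)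
  have r_const: "vietoris_rips Y r' = vietoris_rips Y r" if "r \<le> r'" "r' < d" for r'
  proof (rule vietoris_rips_cong)
    fix x assume "x \<in> distances Y"
    then have "x < d \<Longrightarrow> x \<le> r" by (intro upper) (simp add: C_def)
    then show "x \<le> r' \<longleftrightarrow> x \<le> r" using that by linarith
  qed
  have "\<forall>\<^sub>F \<epsilon> in at_right 0. \<epsilon> < d - r" 
    unfolding eventually_at_right_field using r by (intro exI[of _ "d - r"]) auto
  moreover have "\<forall>\<^sub>F \<epsilon> in at_right (0::real). 0 < \<epsilon>" by (simp add: eventually_at_right_less)
  moreover note eventually_vietoris_rips_right[OF Y, of b]
  ultimately have "\<forall>\<^sub>F \<epsilon> in at_right 0.
       (int (vr_betti p Y (b + \<epsilon>) (d - \<epsilon>)) - int (vr_betti p Y (b - \<epsilon>) (d - \<epsilon>)))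
       - (int (vr_betti p Y (b + \<epsilon>) (d + \<epsilon>)) - int (vr_betti p Y (b - \<epsilon>) (d + \<epsilon>)))
       = int (vr_betti p Y b r)"
  proof eventually_elim
    case (elim \<epsilon>)
    have "?Z (b - \<epsilon>) \<subseteq> ?B t" using elim by (intro below_b) simp
    then have "vr_betti p Y (b - \<epsilon>) (d - \<epsilon>) = 0" "vr_betti p Y (b - \<epsilon>) (d + \<epsilon>) = 0"
      using B_mono[of t "d - \<epsilon>"] B_mono[of t "d + \<epsilon>"] elim r
      by (auto intro!: persistent_betti_eq_0)
    moreover have "vr_betti p Y b (d + \<epsilon>) = 0"
      using d B_mono[of d "d + \<epsilon>"] elim by (intro persistent_betti_eq_0) (auto simp: D_def)
    moreover have "vietoris_rips Y (d - \<epsilon>) = vietoris_rips Y r"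
      using elim by (intro r_const) auto
    ultimately show ?case using elim(3) by simp
  qed
  then have "persistence_multiplicity p Y b d = nat (int (vr_betti p Y b r))"
    by (rule persistence_multiplicity_eqI)
  moreover have "vr_betti p Y b r > 0"
    using below_d[OF r(2)] persistent_betti_pos[OF finite_vietoris_rips[OF Y]] by blast
  ultimately have "(b, d) \<in># persistence_diagram p Y"
    using in_persistence_diagram_iff[OF Y] b(2) \<open>s \<le> t\<close> \<open>t < d\<close> by simp
  then show thesis using that b(2) \<open>t < d\<close> by blast
qed

section \<open>Neighbourhoods of sets with positive reach\<close>

text \<open>
  For a vertex \<open>w\<close>, the point \<open>x\<close> of the hull cannot be separated from the vertices by the hyperplane
  through \<open>x\<close> normal to \<open>w - x\<close>; so some vertex \<open>v\<close> sees \<open>w\<close> from \<open>x\<close> at an angle of at least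
  \<open>\<pi>/2\<close>, and by the law of cosines the nearer of \<open>v\<close> and \<open>w\<close> is within \<open>e / \<surd>2\<close> of \<open>x\<close>.  This is the
  dimension-free form of Jung's inequality.
\<close>

lemma convex_hull_near_vertex:
  fixes S :: "'a::real_inner set"
  assumes diam: "\<And>a b. a \<in> S \<Longrightarrow> b \<in> S \<Longrightarrow> dist a b \<le> e"
    and x: "x \<in> convex hull S"
  obtains v where "v \<in> S" "2 * (dist x v)\<^sup>2 \<le> e\<^sup>2"
proof -
  obtain w where w: "w \<in> S" using x by (metis convex_hull_empty equals0I)
  have "\<exists>v\<in>S. (w - x) \<bullet> (v - x) \<le> 0"
  proof (rule ccontr)
    assume "\<not> ?thesis"
    then have "S \<subseteq> {v. (w - x) \<bullet> v > (w - x) \<bullet> x}"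
      by (auto simp: inner_diff_right not_le)
    then have "convex hull S \<subseteq> {v. (w - x) \<bullet> v > (w - x) \<bullet> x}"
      by (intro hull_minimal convex_halfspace_gt)
    then show False using x by auto
  qed
  then obtain v where v: "v \<in> S" "(w - x) \<bullet> (v - x) \<le> 0" by blast
  have "(dist w v)\<^sup>2 = (dist x w)\<^sup>2 + (dist x v)\<^sup>2 - 2 * ((w - x) \<bullet> (v - x))"
    by (simp add: dist_norm power2_norm_eq_inner inner_diff_left inner_diff_right inner_commute)
  moreover have "(dist w v)\<^sup>2 \<le> e\<^sup>2" using diam[OF w v(1)] by (intro power_mono) auto
  ultimately have "(dist x w)\<^sup>2 + (dist x v)\<^sup>2 \<le> e\<^sup>2" using v(2) by linarith
  then have "2 * (dist x w)\<^sup>2 \<le> e\<^sup>2 \<or> 2 * (dist x v)\<^sup>2 \<le> e\<^sup>2" by linarith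
  then show thesis using that w v(1) by blast
qed

lemma infdist_convex_hull_less:
  fixes S :: "'a::real_inner set"
  assumes "S \<subseteq> K" and "\<And>a b. a \<in> S \<Longrightarrow> b \<in> S \<Longrightarrow> dist a b \<le> e"
    and "x \<in> convex hull S" and "e\<^sup>2 < 2 * R\<^sup>2" "0 < R"
  shows "infdist x K < R"
proof -
  obtain v where v: "v \<in> S" "2 * (dist x v)\<^sup>2 \<le> e\<^sup>2"
    using convex_hull_near_vertex assms(2,3) by blast
  then have "(dist x v)\<^sup>2 < R\<^sup>2" using assms(4) by linarith
  then have "dist x v < R" by (rule power2_less_imp_less) (use assms(5) in simp)
  then show ?thesis using infdist_le[of v K x] v(1) assms(1) by auto
qed

lemma nearest_point_unique_within_reach:
  assumes "reach K = ennreal R" "infdist x K < R"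
  shows "\<exists>!y. y \<in> K \<and> dist x y = infdist x K"
proof -
  have "ennreal (infdist x K) < reach K"
    using assms by (simp add: ennreal_less_iff infdist_nonneg)
  then obtain r where r: "0 < r" "ennreal (infdist x K) < ennreal r"
      "\<forall>x. infdist x K < r \<longrightarrow> (\<exists>!y. y \<in> K \<and> dist x y = infdist x K)"
    unfolding reach_def less_SUP_iff by blast
  then show ?thesis by (simp add: ennreal_less_iff infdist_nonneg)
qed

text \<open>
  The graph of the projection is cut out of the product by one closed condition, and the target is
  compact; the closed graph theorem gives continuity.
\<close>

lemma nearest_point_projection:
  fixes K :: "'a::euclidean_space set"
  assumes "compact K"
    and unique: "\<And>x. infdist x K < R \<Longrightarrow> \<exists>!y. y \<in> K \<and> dist x y = infdist x K"
  obtains \<pi> where "continuous_on {x. infdist x K < R} \<pi>" "\<pi> \<in> {x. infdist x K < R} \<rightarrow> K"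
    "\<And>x. x \<in> K \<Longrightarrow> 0 < R \<Longrightarrow> \<pi> x = x"
proof -
  let ?N = "{x. infdist x K < R}"
  define \<pi> where "\<pi> x = (THE y. y \<in> K \<and> dist x y = infdist x K)" for x
  have \<pi>: "\<pi> x \<in> K" "dist x (\<pi> x) = infdist x K" if "x \<in> ?N" for x
    using theI'[OF unique[of x]] that by (auto simp: \<pi>_def)
  have \<pi>_eq: "\<pi> x = y" if "x \<in> ?N" "y \<in> K" "dist x y = infdist x K" for x y
    using unique[of x] \<pi>[OF that(1)] that by blast
  have "closed {p. dist (fst p) (snd p) = infdist (fst p) K}"
    by (intro closed_Collect_eq continuous_intros)
  moreover have "(\<lambda>x. (x, \<pi> x)) ` ?N = (?N \<times> K) \<inter> {p. dist (fst p) (snd p) = infdist (fst p) K}"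
  proof (intro subset_antisym subsetI)
    fix p assume "p \<in> (?N \<times> K) \<inter> {p. dist (fst p) (snd p) = infdist (fst p) K}"
    then show "p \<in> (\<lambda>x. (x, \<pi> x)) ` ?N" using \<pi>_eq by (cases p) force
  qed (use \<pi> in auto)
  ultimately have "continuous_on ?N \<pi>"
    using \<pi>(1) \<open>compact K\<close>
    by (subst continuous_closed_graph_eq[of K]) (auto simp: closedin_closed)
  moreover have "\<pi> x = x" if "x \<in> K" "0 < R" for x
    using that by (intro \<pi>_eq) simp_all
  ultimately show thesis using that \<pi>(1) by blast
qed

section \<open>Winding numbers of polygons inscribed in a closed curve\<close>

text \<open>
  Two logarithms of the same function differ by a continuous function with values in the discrete
  group \<open>2\<pi>\<i>\<int>\<close>, which is constant on a connected set.
\<close>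

lemma logarithm_increment_unique:
  fixes f g :: "'a::topological_space \<Rightarrow> complex"
  assumes "connected S" "continuous_on S f" "continuous_on S g"
    and "\<And>z. z \<in> S \<Longrightarrow> exp (f z) = exp (g z)" and "x \<in> S" "y \<in> S"
  shows "f y - f x = g y - g x"
proof -
  have "(\<lambda>z. f z - g z) constant_on S"
  proof (rule continuous_discrete_range_constant[OF assms(1)])
    show "continuous_on S (\<lambda>z. f z - g z)" using assms by (intro continuous_intros)
    fix z assume z: "z \<in> S"
    have "2 * pi \<le> norm ((f u - g u) - (f z - g z))" if "u \<in> S" "f u - g u \<noteq> f z - g z" for u
    proof -
      have "exp (f u) = exp (g u)" "exp (f z) = exp (g z)" using assms(4) z that by simp_all
      then obtain j k :: int where "f u = g u + of_int (2 * j) * pi * \<i>"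
          "f z = g z + of_int (2 * k) * pi * \<i>"
        unfolding exp_eq by blast
      then have d: "(f u - g u) - (f z - g z) = of_real (2 * pi * of_int (j - k)) * \<i>"
        by (simp add: algebra_simps)
      then have "j \<noteq> k" using that(2) by auto
      then have "1 \<le> \<bar>real_of_int (j - k)\<bar>" by linarith
      then have "2 * pi * 1 \<le> 2 * pi * \<bar>real_of_int (j - k)\<bar>" by (intro mult_left_mono) auto
      then show ?thesis unfolding d norm_mult norm_of_real norm_ii by (simp only: abs_mult) simp
    qed
    then show "\<exists>r>0. \<forall>u. u \<in> S \<and> f u - g u \<noteq> f z - g z \<longrightarrow> r \<le> norm ((f u - g u) - (f z - g z))"
      using pi_gt_zero by (intro exI[of _ "2 * pi"]) auto
  qed
  then obtain c where "\<And>z. z \<in> S \<Longrightarrow> f z - g z = c" by (auto simp: constant_on_def)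
  then have "f y - g y = f x - g x" using assms by simp
  then show ?thesis by (simp add: algebra_simps)
qed

text \<open>
  The argument of \<open>\<psi>\<close> plays the role of the angle, defined on a neighbourhood of \<open>K\<close> that contains the convex hull
  of every subset of \<open>K\<close> of diameter at most \<open>e\<close>.  On such a hull \<open>\<psi>\<close> has a continuous logarithm, whose
  increment from \<open>x\<close> to \<open>y\<close> depends on the two points only.  Comparing it with the increment of the
  discontinuous principal logarithm leaves an integer \<open>n x y\<close>.  Logarithms on the hull of a triangle
  make \<open>n\<close> a cocycle; logarithms on the hulls of short arcs show that \<open>n\<close> sums to \<open>1\<close> around the curve,
  because the true angle makes one turn while the principal logarithm telescopes to zero.  Integer
  values are essential: they can be reduced modulo two and then paired with chains.
\<close>

lemma integer_cocycle_of_circle_map: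
  fixes K :: "'a::euclidean_space set" and \<psi> :: "'a \<Rightarrow> complex" and \<gamma> :: "real \<Rightarrow> 'a"
  assumes \<psi>: "continuous_on {x. infdist x K < R} \<psi>" "\<And>x. infdist x K < R \<Longrightarrow> \<psi> x \<noteq> 0"
    and e: "e\<^sup>2 < 2 * R\<^sup>2" "0 < R" "0 \<le> e"
    and \<gamma>: "continuous_on {0..1} \<gamma>" "\<gamma> ` {0..1} \<subseteq> K" "\<gamma> 0 = \<gamma> 1"
    and \<psi>\<gamma>: "\<And>t. t \<in> {0..1} \<Longrightarrow> \<psi> (\<gamma> t) = exp (2 * of_real pi * \<i> * of_real t)"
  obtains n :: "'a \<Rightarrow> 'a \<Rightarrow> int" where
    "\<And>x y z. x \<in> K \<Longrightarrow> y \<in> K \<Longrightarrow> z \<in> K \<Longrightarrow> dist x y \<le> e \<Longrightarrow> dist y z \<le> e \<Longrightarrow> dist x z \<le> e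
       \<Longrightarrow> n x z = n x y + n y z"
    "\<And>N. 0 < N \<Longrightarrow>
       \<forall>s\<in>{0..1}. \<forall>t\<in>{0..1}. \<bar>s - t\<bar> \<le> 1 / real N \<longrightarrow> dist (\<gamma> s) (\<gamma> t) \<le> e \<Longrightarrow>
       (\<Sum>i<N. n (\<gamma> (real i / real N)) (\<gamma> (real (Suc i) / real N))) = 1"
proof -
  define small where "small S \<longleftrightarrow> S \<subseteq> K \<and> (\<forall>a\<in>S. \<forall>b\<in>S. dist a b \<le> e)" for S
  define is_log where
    "is_log S L \<longleftrightarrow> continuous_on (convex hull S) L \<and> (\<forall>z\<in>convex hull S. \<psi> z = exp (L z))" for S L
  have ex_log: "\<exists>L. is_log S L" if "small S" for S
  proof -
    have near: "infdist z K < R" if "z \<in> convex hull S" for z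
      using infdist_convex_hull_less[of S K e z R] \<open>small S\<close> that e by (auto simp: small_def)
    then have "continuous_on (convex hull S) \<psi>" by (intro continuous_on_subset[OF \<psi>(1)]) auto
    then obtain L where "continuous_on (convex hull S) L" "\<And>z. z \<in> convex hull S \<Longrightarrow> \<psi> z = exp (L z)"
      using continuous_logarithm_on_contractible[of "convex hull S" \<psi>] \<psi>(2) near
        convex_imp_contractible[OF convex_convex_hull] by blast
    then show ?thesis by (auto simp: is_log_def)
  qed
  define \<theta> where "\<theta> x = Ln (\<psi> x)" for x
  have exp_\<theta>: "exp (\<theta> x) = \<psi> x" if "x \<in> K" for x
    using \<psi>(2)[of x] that e by (simp add: \<theta>_def)
  \<comment> \<open>the integer must serve all logarithms at once, so that triangles and arcs can be compared\<close>
  define turns where "turns x y k \<longleftrightarrow> (\<forall>S L. small S \<and> is_log S L \<and> x \<in> S \<and> y \<in> S \<longrightarrow>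
      L y - L x = \<theta> y - \<theta> x + 2 * of_real pi * \<i> * of_int k)" for x y and k :: int
  have ex_turns: "\<exists>k. turns x y k" if "x \<in> K" "y \<in> K" "dist x y \<le> e" for x y
  proof -
    have "small {x, y}" using that e by (auto simp: small_def dist_commute)
    then obtain L where L: "is_log {x, y} L" using ex_log by blast
    have "x \<in> convex hull {x, y}" "y \<in> convex hull {x, y}" by (auto intro: hull_inc)
    then have "exp (L x) = exp (\<theta> x)" "exp (L y) = exp (\<theta> y)"
      using L exp_\<theta> that by (auto simp: is_log_def)
    then obtain j k :: int where jk: "L x = \<theta> x + of_int (2 * j) * pi * \<i>" "L y = \<theta> y + of_int (2 * k) * pi * \<i>"
      unfolding exp_eq by blast
    have "turns x y (k - j)"
      unfolding turns_def
    proof (intro allI impI, elim conjE)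
      fix S L' assume S: "small S" "is_log S L'" "x \<in> S" "y \<in> S"
      then have sub: "convex hull {x, y} \<subseteq> convex hull S" by (intro hull_mono) auto
      have "L' y - L' x = L y - L x"
      proof (rule logarithm_increment_unique[of "convex hull {x, y}"])
        show "exp (L' z) = exp (L z)" if "z \<in> convex hull {x, y}" for z
          using S(2) L sub that by (force simp: is_log_def)
      qed (use S(2) L sub in \<open>auto simp: is_log_def convex_connected hull_inc
             intro: continuous_on_subset\<close>)
      then show "L' y - L' x = \<theta> y - \<theta> x + 2 * of_real pi * \<i> * of_int (k - j)"
        by (simp add: jk algebra_simps)
    qed
    then show ?thesis by blast
  qed
  define n where "n x y = (SOME k. turns x y k)" for x y
  have increment: "L y - L x = \<theta> y - \<theta> x + 2 * of_real pi * \<i> * of_int (n x y)"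
    if "small S" "is_log S L" "x \<in> S" "y \<in> S" for S L x y
  proof -
    have "x \<in> K" "y \<in> K" "dist x y \<le> e" using that by (auto simp: small_def)
    then have "turns x y (n x y)" unfolding n_def by (rule someI_ex[OF ex_turns])
    then show ?thesis using that by (auto simp: turns_def)
  qed

  show thesis
  proof
    fix x y z assume "x \<in> K" "y \<in> K" "z \<in> K" "dist x y \<le> e" "dist y z \<le> e" "dist x z \<le> e"
    then have S: "small {x, y, z}" using e by (auto simp: small_def dist_commute)
    then obtain L where L: "is_log {x, y, z} L" using ex_log by blast
    have inc: "2 * of_real pi * \<i> * of_int (n u v) = (L v - L u) - (\<theta> v - \<theta> u)"
      if "u \<in> {x, y, z}" "v \<in> {x, y, z}" for u v
      using increment[OF S L that] by simp
    have "2 * of_real pi * \<i> * of_int (n x z) = 2 * of_real pi * \<i> * of_int (n x y)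
        + 2 * of_real pi * \<i> * of_int (n y z)"
      by (simp only: inc insert_iff simp_thms) simp
    then have "2 * of_real pi * \<i> * (of_int (n x z) :: complex) = 2 * of_real pi * \<i> * of_int (n x y + n y z)"
      by (simp only: of_int_add distrib_left)
    then have "(of_int (n x z) :: complex) = of_int (n x y + n y z)" by simp
    then show "n x z = n x y + n y z" by (simp only: of_int_eq_iff)
  next
    fix N :: nat
    assume N: "0 < N"
      and fine: "\<forall>s\<in>{0..1}. \<forall>t\<in>{0..1}. \<bar>s - t\<bar> \<le> 1 / real N \<longrightarrow> dist (\<gamma> s) (\<gamma> t) \<le> e"
    let ?t = "\<lambda>i. real i / real N"
    let ?n = "\<lambda>i. n (\<gamma> (?t i)) (\<gamma> (?t (Suc i)))"
    have step: "2 * of_real pi * \<i> * of_real (1 / real N)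
        = \<theta> (\<gamma> (?t (Suc i))) - \<theta> (\<gamma> (?t i)) + 2 * of_real pi * \<i> * of_int (?n i)" if "i < N" for i
    proof -
      let ?I = "{?t i..?t (Suc i)}"
      have I: "?I \<subseteq> {0..1}" "?t i \<in> ?I" "?t (Suc i) \<in> ?I" and width: "?t (Suc i) = ?t i + 1 / real N"
        using that by (auto simp: field_simps)
      have "dist (\<gamma> s) (\<gamma> t) \<le> e" if "s \<in> ?I" "t \<in> ?I" for s t
      proof -
        have "s \<in> {0..1}" "t \<in> {0..1}" using that I(1) by blast+
        moreover have "\<bar>s - t\<bar> \<le> 1 / real N" using that width unfolding atLeastAtMost_iff by linarith
        ultimately show ?thesis using fine by blast
      qed
      moreover have "\<gamma> ` ?I \<subseteq> K" using \<gamma>(2) I(1) by blast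
      ultimately have S: "small (\<gamma> ` ?I)" unfolding small_def by blast
      then obtain L where L: "is_log (\<gamma> ` ?I) L" using ex_log by blast
      have "L (\<gamma> (?t (Suc i))) - L (\<gamma> (?t i))
          = 2 * of_real pi * \<i> * of_real (?t (Suc i)) - 2 * of_real pi * \<i> * of_real (?t i)"
      proof (rule logarithm_increment_unique[of ?I "\<lambda>t. L (\<gamma> t)"])
        show "continuous_on ?I (\<lambda>t. L (\<gamma> t))"
          using L unfolding is_log_def
          by (intro continuous_on_compose2[OF _ continuous_on_subset[OF \<gamma>(1) I(1)] hull_subset]) blast
        show "exp (L (\<gamma> t)) = exp (2 * of_real pi * \<i> * of_real t)" if "t \<in> ?I" for t
        proof -
          have "\<gamma> t \<in> convex hull (\<gamma> ` ?I)" using that by (intro hull_inc imageI)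
          then have "exp (L (\<gamma> t)) = \<psi> (\<gamma> t)" using L by (simp add: is_log_def)
          then show ?thesis using \<psi>\<gamma> that I(1) by (metis subsetD)
        qed
      qed (use I in \<open>auto intro!: continuous_intros\<close>)
      also have "\<dots> = 2 * of_real pi * \<i> * of_real (1 / real N)"
        unfolding width by (simp add: algebra_simps)
      finally show ?thesis
        using increment[OF S L, of "\<gamma> (?t i)" "\<gamma> (?t (Suc i))"] I by simp
    qed
    have "(\<Sum>i<N. 2 * of_real pi * \<i> * of_real (1 / real N))
        = (\<Sum>i<N. (\<theta> (\<gamma> (?t (Suc i))) - \<theta> (\<gamma> (?t i))) + 2 * of_real pi * \<i> * of_int (?n i))"
      using step by (intro sum.cong) auto
    also have "\<dots> = \<theta> (\<gamma> (?t N)) - \<theta> (\<gamma> (?t 0)) + 2 * of_real pi * \<i> * of_int (\<Sum>i<N. ?n i)"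
      by (simp only: sum.distrib sum_lessThan_telescope[of "\<lambda>i. \<theta> (\<gamma> (?t i))"]
            of_int_sum sum_distrib_left)
    also have "\<theta> (\<gamma> (?t N)) - \<theta> (\<gamma> (?t 0)) = 0" using N \<gamma>(3) by simp
    finally have "2 * of_real pi * \<i> = 2 * of_real pi * \<i> * (of_int (\<Sum>i<N. ?n i) :: complex)"
      using N by simp
    then have "(of_int (\<Sum>i<N. ?n i) :: complex) = of_int 1" by simp
    then show "(\<Sum>i<N. ?n i) = 1" by (simp only: of_int_eq_iff)
  qed
qed

text \<open>
  The graph of the angle function is the compact image of the unit interval, hence closed, and the
  values lie on a circle: the closed graph theorem again.
\<close>

lemma angle_on_simple_closed_curve:
  fixes \<gamma> :: "real \<Rightarrow> 'a::euclidean_space"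
  assumes \<gamma>: "continuous_on {0..1} \<gamma>" "\<gamma> 0 = \<gamma> 1" "inj_on \<gamma> {0..<1}"
  obtains \<phi> :: "'a \<Rightarrow> complex" where "continuous_on (\<gamma> ` {0..1}) \<phi>"
    "\<And>t. t \<in> {0..1} \<Longrightarrow> \<phi> (\<gamma> t) = exp (2 * of_real pi * \<i> * of_real t)"
proof -
  let ?c = "\<lambda>t::real. exp (2 * of_real pi * \<i> * of_real t) :: complex"
  define \<phi> where "\<phi> x = ?c (SOME t. t \<in> {0..1} \<and> \<gamma> t = x)" for x
  have same: "?c s = ?c t" if "s \<in> {0..1}" "t \<in> {0..1}" "\<gamma> s = \<gamma> t" for s t
  proof -
    define r where "r x = (if x = 1 then 0 else x)" for x :: real
    have r: "r x \<in> {0..<1}" "\<gamma> (r x) = \<gamma> x" "?c (r x) = ?c x" if "x \<in> {0..1}" for x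
      using that \<gamma>(2) by (auto simp: r_def)
    have "r s = r t" using \<gamma>(3) r that by (metis inj_onD)
    then show ?thesis using r(3) that by metis
  qed
  have \<phi>: "\<phi> (\<gamma> t) = ?c t" if "t \<in> {0..1}" for t
  proof -
    have "(SOME s. s \<in> {0..1} \<and> \<gamma> s = \<gamma> t) \<in> {0..1} \<and> \<gamma> (SOME s. s \<in> {0..1} \<and> \<gamma> s = \<gamma> t) = \<gamma> t"
      using someI_ex[of "\<lambda>s. s \<in> {0..1} \<and> \<gamma> s = \<gamma> t"] that by blast
    then show ?thesis unfolding \<phi>_def using that by (intro same) auto
  qed
  have "(\<lambda>x. (x, \<phi> x)) ` \<gamma> ` {0..1} = (\<lambda>t. (\<gamma> t, ?c t)) ` {0..1}"
    unfolding image_image using \<phi> by (intro image_cong) auto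
  moreover have "compact ((\<lambda>t. (\<gamma> t, ?c t)) ` {0..1})"
    by (intro compact_continuous_image continuous_intros \<gamma>(1) compact_Icc)
  moreover have "\<phi> \<in> \<gamma> ` {0..1} \<rightarrow> sphere 0 1" using \<phi> by auto
  ultimately have "continuous_on (\<gamma> ` {0..1}) \<phi>"
    by (intro continuous_from_closed_graph[of "sphere 0 1"] compact_sphere) (auto dest: compact_imp_closed)
  then show thesis using that \<phi> by blast
qed

section \<open>Persistence of sampled closed curves\<close>

lemma hausdorff_dist_nearby:
  fixes A B :: "'a::heine_borel set"
  assumes "compact A" "compact B" "A \<noteq> {}" "B \<noteq> {}" and r: "hausdorff_dist A B \<le> r"
  shows "a \<in> A \<Longrightarrow> \<exists>b\<in>B. dist a b \<le> r" and "b \<in> B \<Longrightarrow> \<exists>a\<in>A. dist b a \<le> r"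
proof -
  have bdd: "bdd_above ((\<lambda>x. infdist x D) ` C)" if "compact C" for C D :: "'a set"
    using that
    by (intro bounded_imp_bdd_above compact_imp_bounded compact_continuous_image continuous_intros)
  have attained: "\<exists>d\<in>D. dist x d \<le> r" if "infdist x D \<le> r" "compact D" "D \<noteq> {}" for x and D :: "'a set"
    using infdist_attains_inf[OF compact_imp_closed[OF that(2)] that(3), of x] that(1) by metis
  show "\<exists>b\<in>B. dist a b \<le> r" if "a \<in> A"
    using cSUP_upper[OF that bdd[OF \<open>compact A\<close>], of B] r
    by (intro attained assms) (simp add: hausdorff_dist_def)
  show "\<exists>a\<in>A. dist b a \<le> r" if "b \<in> B"
    using cSUP_upper[OF that bdd[OF \<open>compact B\<close>], of A] r
    by (intro attained assms) (simp add: hausdorff_dist_def)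
qed

text \<open>
  Consecutive vertices may coincide, in which case there is no edge to add; the boundaries still
  telescope because twice a vertex is zero.
\<close>

lemma polygon_is_cycle:
  fixes x :: "nat \<Rightarrow> 'a"
  assumes "x N = x 0"
  shows "boundary (\<Sum>i<N. if x i = x (Suc i) then 0 else Poly_Mapping.single {x i, x (Suc i)} 1) = 0"
    (is "boundary (\<Sum>i<N. ?E i) = 0")
proof -
  let ?v = "\<lambda>i. Poly_Mapping.single {x i} 1 :: 'a chain"
  have "boundary (?E i) = ?v i + ?v (Suc i)" for i
    by (simp add: boundary_single facet_sum_edge chain_add_self boundary_eq_extend_linearly)
  then have "boundary (\<Sum>i<n. ?E i) = (\<Sum>i<n. ?v i + ?v (Suc i))" for n
    by (simp only: boundary_sum)
  moreover have "(\<Sum>i<n. ?v i + ?v (Suc i)) = ?v 0 + ?v n" for n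
  proof (induction n)
    case (Suc n)
    have "(\<Sum>i<Suc n. ?v i + ?v (Suc i)) = ?v 0 + (?v n + ?v n) + ?v (Suc n)"
      using Suc by (simp add: add.assoc)
    then show ?case by (simp only: chain_add_self add_0_right)
  qed (simp add: chain_add_self)
  ultimately have "boundary (\<Sum>i<N. ?E i) = ?v 0 + ?v N" by metis
  then show ?thesis using assms by (simp add: chain_add_self)
qed

lemma cocycle_vanishes_on_boundaries:
  fixes g :: "'a set \<Rightarrow> bit"
  assumes triangle: "\<And>x y z. {x, y, z} \<in> K \<Longrightarrow> x \<noteq> y \<Longrightarrow> y \<noteq> z \<Longrightarrow> x \<noteq> z \<Longrightarrow>
      g {y, z} + g {x, z} + g {x, y} = 0"
    and c: "c \<in> boundaries 1 K"
  shows "extend_linearly g c = 0"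
proof -
  note lin = extend_linearly_sum[OF bit_add_self] extend_linearly_add[OF bit_add_self]
  obtain b where b: "b \<in> chains 2 K" "c = boundary b"
    using c by (auto simp: boundaries_def numeral_2_eq_2)
  have "extend_linearly g (facet_sum \<sigma>) = 0" if "\<sigma> \<in> Poly_Mapping.keys b" for \<sigma>
  proof -
    have \<sigma>: "\<sigma> \<in> K" "card \<sigma> = 3" using b(1) that by (auto simp: chains_def)
    then obtain x y z where xyz: "\<sigma> = {x, y, z}" "x \<noteq> y" "y \<noteq> z" "x \<noteq> z"
      by (auto simp: card_3_iff)
    have "\<sigma> - {x} = {y, z}" "\<sigma> - {y} = {x, z}" "\<sigma> - {z} = {x, y}" using xyz by auto
    moreover from this have "{v. v \<in> \<sigma> \<and> \<sigma> - {v} \<noteq> {}} = {x, y, z}" using xyz by auto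
    ultimately have "facet_sum \<sigma> = Poly_Mapping.single {y, z} 1
        + (Poly_Mapping.single {x, z} 1 + Poly_Mapping.single {x, y} 1)"
      unfolding facet_sum_def using xyz(2-) by simp
    then have "extend_linearly g (facet_sum \<sigma>) = g {y, z} + g {x, z} + g {x, y}"
      by (simp only: lin extend_linearly_single add.assoc)
    then show ?thesis using triangle[of x y z] xyz \<sigma>(1) by simp
  qed
  then show ?thesis
    unfolding b(2) boundary_eq_extend_linearly extend_linearly_def[of facet_sum] lin
    by (simp add: sum.neutral)
qed

text \<open>
  Follow a fine subdivision \<open>z\<close> of the curve by sample points \<open>x\<close>: they form a polygon with edges of length
  at most \<open>2\<rho> + \<kappa>\<close>.  Pushing sample points back to the curve by \<open>p\<close> turns edges of length at most \<open>t\<close> into pairs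
  at distance at most \<open>e\<close>, where the winding cocycle is defined; so the cocycle, reduced modulo two and
  pulled back along \<open>p\<close>, vanishes on all boundaries at scale \<open>t\<close>.  Yet it is \<open>1\<close> on the polygon: the points
  \<open>y\<close> to which the vertices return are displaced from \<open>z\<close>, but the cocycle relation on the triangles
  between the two polygons shows that both wind once.
\<close>

lemma sampled_closed_curve_diagram_point:
  fixes \<gamma> :: "real \<Rightarrow> 'a::euclidean_space"
  assumes \<gamma>: "continuous_on {0..1} \<gamma>" "\<gamma> 0 = \<gamma> 1" "inj_on \<gamma> {0..<1}"
    and K: "K = \<gamma> ` {0..1}"
    and unique: "\<And>x. infdist x K < R \<Longrightarrow> \<exists>!y. y \<in> K \<and> dist x y = infdist x K"
    and R: "e\<^sup>2 < 2 * R\<^sup>2" "0 < R"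
    and X: "finite X"
    and near_X: "\<And>z. z \<in> K \<Longrightarrow> \<exists>x\<in>X. dist z x \<le> \<rho>"
    and near_K: "\<And>x. x \<in> X \<Longrightarrow> \<exists>z\<in>K. dist x z \<le> q"
    and pos: "0 < \<kappa>" "0 \<le> q" and scales: "2 * \<rho> + \<kappa> \<le> t" "t + 2 * q \<le> e" "\<rho> + q + \<kappa> \<le> e"
  obtains b d where "(b, d) \<in># persistence_diagram 1 X" "b \<le> 2 * \<rho> + \<kappa>" "t < d"
proof -
  have \<rho>: "0 \<le> \<rho>" using near_X[of "\<gamma> 0"] K by (auto intro: order_trans[OF zero_le_dist])
  then have e: "0 \<le> e" "\<kappa> \<le> e" using scales pos by linarith+
  have "compact K" unfolding K using \<gamma>(1) by (intro compact_continuous_image) auto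
  obtain \<pi> where \<pi>: "continuous_on {x. infdist x K < R} \<pi>" "\<pi> \<in> {x. infdist x K < R} \<rightarrow> K"
      "\<And>x. x \<in> K \<Longrightarrow> 0 < R \<Longrightarrow> \<pi> x = x"
    using nearest_point_projection[OF \<open>compact K\<close> unique] by blast
  obtain \<phi> :: "'a \<Rightarrow> complex" where \<phi>: "continuous_on K \<phi>"
      "\<And>t. t \<in> {0..1} \<Longrightarrow> \<phi> (\<gamma> t) = exp (2 * of_real pi * \<i> * of_real t)"
    using angle_on_simple_closed_curve[OF \<gamma>] unfolding K by blast
  have cont: "continuous_on {x. infdist x K < R} (\<lambda>x. \<phi> (\<pi> x))"
    using \<pi>(2) by (intro continuous_on_compose2[OF \<phi>(1) \<pi>(1)]) blast
  have nonzero: "\<phi> (\<pi> x) \<noteq> 0" if "infdist x K < R" for x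
  proof -
    have "\<pi> x \<in> K" using \<pi>(2) that by auto
    then show ?thesis using \<phi>(2) unfolding K by auto
  qed
  have \<psi>\<gamma>: "\<phi> (\<pi> (\<gamma> t)) = exp (2 * of_real pi * \<i> * of_real t)" if "t \<in> {0..1}" for t
    using that \<pi>(3)[of "\<gamma> t"] \<phi>(2)[OF that] R(2) by (simp add: K)
  obtain n :: "'a \<Rightarrow> 'a \<Rightarrow> int" where
    cocycle: "\<And>x y z. x \<in> K \<Longrightarrow> y \<in> K \<Longrightarrow> z \<in> K \<Longrightarrow> dist x y \<le> e \<Longrightarrow> dist y z \<le> e \<Longrightarrow> dist x z \<le> e
       \<Longrightarrow> n x z = n x y + n y z" and
    winding: "\<And>N. 0 < N \<Longrightarrow>
       \<forall>s\<in>{0..1}. \<forall>t\<in>{0..1}. \<bar>s - t\<bar> \<le> 1 / real N \<longrightarrow> dist (\<gamma> s) (\<gamma> t) \<le> e \<Longrightarrow>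
       (\<Sum>i<N. n (\<gamma> (real i / real N)) (\<gamma> (real (Suc i) / real N))) = 1"
    by (rule integer_cocycle_of_circle_map[OF cont nonzero R e(1) \<gamma>(1) _ \<gamma>(2) \<psi>\<gamma>])
      (use K in blast)+
  have n_refl: "n x x = 0" if "x \<in> K" for x
    using cocycle[of x x x] that e(1) by simp
  have n_sym: "n x y = - n y x" if "x \<in> K" "y \<in> K" "dist x y \<le> e" for x y
    using cocycle[of x y x] n_refl[of x] that e(1) by (simp add: dist_commute)

  have "uniformly_continuous_on {0..1} \<gamma>" using \<gamma>(1) by (intro compact_uniformly_continuous) auto
  then obtain \<delta> where \<delta>: "\<delta> > 0"
      "\<And>s t. s \<in> {0..1} \<Longrightarrow> t \<in> {0..1} \<Longrightarrow> dist s t < \<delta> \<Longrightarrow> dist (\<gamma> s) (\<gamma> t) < \<kappa>"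
    unfolding uniformly_continuous_on_def using pos(1) by metis
  obtain N where N: "N > 0" "1 / real N < \<delta>"
    using reals_Archimedean[OF \<delta>(1)] by (metis inverse_eq_divide zero_less_Suc)
  have fine: "dist (\<gamma> s) (\<gamma> t) \<le> \<kappa>" if "s \<in> {0..1}" "t \<in> {0..1}" "\<bar>s - t\<bar> \<le> 1 / real N" for s t
    using \<delta>(2)[of s t] that N by (simp add: dist_real_def)

  define z where "z i = \<gamma> (real i / real N)" for i
  have z: "z i \<in> K" if "i \<le> N" for i
    unfolding z_def K using that N by (intro imageI) auto
  have z_step: "dist (z i) (z (Suc i)) \<le> \<kappa>" if "i < N" for i
    unfolding z_def using that N by (intro fine) (auto simp: field_simps)
  have z_closed: "z N = z 0" using \<gamma>(2) N by (simp add: z_def)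
  have z_winding: "(\<Sum>i<N. n (z i) (z (Suc i))) = 1"
    unfolding z_def using N fine e(2) by (intro winding) force+

  obtain f where f: "\<And>z. z \<in> K \<Longrightarrow> f z \<in> X \<and> dist z (f z) \<le> \<rho>" using near_X by metis
  obtain p where p: "\<And>x. x \<in> X \<Longrightarrow> p x \<in> K \<and> dist x (p x) \<le> q" using near_K by metis
  have p_dist: "dist (p x) (p y) \<le> e" if "x \<in> X" "y \<in> X" "dist x y \<le> t" for x y
  proof -
    have "dist (p x) (p y) \<le> dist x (p x) + dist x y + dist y (p y)" by metric
    also have "\<dots> \<le> e" using p[of x] p[of y] that scales(2) by linarith
    finally show ?thesis .
  qed
  define x where "x i = f (z i)" for i
  have x: "x i \<in> X" "dist (z i) (x i) \<le> \<rho>" if "i \<le> N" for i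
    using f z that by (auto simp: x_def)
  have x_step: "dist (x i) (x (Suc i)) \<le> 2 * \<rho> + \<kappa>" if "i < N" for i
  proof -
    have "dist (x i) (x (Suc i)) \<le> dist (z i) (x i) + dist (z i) (z (Suc i)) + dist (z (Suc i)) (x (Suc i))"
      by metric
    also have "\<dots> \<le> 2 * \<rho> + \<kappa>" using x(2)[of i] x(2)[of "Suc i"] z_step[of i] that by simp
    finally show ?thesis .
  qed
  define y where "y i = p (x i)" for i
  have y: "y i \<in> K" "dist (z i) (y i) \<le> \<rho> + q" if "i \<le> N" for i
  proof -
    have "dist (z i) (y i) \<le> dist (z i) (x i) + dist (x i) (p (x i))" unfolding y_def by metric
    then show "dist (z i) (y i) \<le> \<rho> + q" using x p that by force
    show "y i \<in> K" using x(1) p that by (auto simp: y_def)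
  qed
  have y_step: "dist (y i) (y (Suc i)) \<le> e" if "i < N" for i
    unfolding y_def using x(1) x_step[OF that] that scales(1) by (intro p_dist) auto
  have y_winding: "(\<Sum>i<N. n (y i) (y (Suc i))) = 1"
  proof -
    have "n (y i) (y (Suc i)) = n (z i) (z (Suc i)) + (n (z (Suc i)) (y (Suc i)) - n (z i) (y i))"
      if "i < N" for i
    proof -
      have "dist (z i) (y (Suc i)) \<le> dist (z i) (z (Suc i)) + dist (z (Suc i)) (y (Suc i))" by metric
      then have d: "dist (z i) (y (Suc i)) \<le> e"
        using z_step[OF that] y(2)[of "Suc i"] that scales(3) by simp
      have close: "dist (z j) (y j) \<le> e" if "j \<le> N" for j
        using y(2)[OF that] scales(3) pos by linarith
      have "n (z i) (y (Suc i)) = n (z i) (z (Suc i)) + n (z (Suc i)) (y (Suc i))"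
        using z y z_step[OF that] e that d close by (intro cocycle) auto
      moreover have "n (z i) (y (Suc i)) = n (z i) (y i) + n (y i) (y (Suc i))"
        using z y y_step[OF that] that d close by (intro cocycle) auto
      ultimately show ?thesis by simp
    qed
    then have "(\<Sum>i<N. n (y i) (y (Suc i)))
        = (\<Sum>i<N. n (z i) (z (Suc i)) + (n (z (Suc i)) (y (Suc i)) - n (z i) (y i)))"
      by (intro sum.cong) auto
    also have "\<dots> = 1 + (n (z N) (y N) - n (z 0) (y 0))"
      by (simp only: sum.distrib z_winding sum_lessThan_telescope[of "\<lambda>i. n (z i) (y i)"])
    also have "\<dots> = 1" using z_closed by (simp add: y_def x_def)
    finally show ?thesis .
  qed

  \<comment> \<open>reduced modulo two, the antisymmetric cocycle becomes a function of unordered edges\<close>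
  define g :: "'a set \<Rightarrow> bit" where
    "g \<sigma> = (let (u, v) = (SOME (u, v). \<sigma> = {u, v}) in of_int (n (p u) (p v)))" for \<sigma>
  have g: "g {u, v} = of_int (n (p u) (p v))" if "u \<in> X" "v \<in> X" "dist u v \<le> t" for u v
  proof -
    obtain u' v' where some: "(SOME (u', v'). {u, v} = {u', v'}) = (u', v')" by (metis surj_pair)
    have "{u, v} = {u', v'}"
      using someI[of "\<lambda>(u', v'). {u, v} = {u', v'}" "(u, v)"] some by simp
    then have "u' = u \<and> v' = v \<or> u' = v \<and> v' = u" by (metis doubleton_eq_iff)
    moreover have "(of_int (n (p v) (p u)) :: bit) = of_int (n (p u) (p v))"
      using n_sym[of "p u" "p v"] p p_dist[OF that] that by simp
    ultimately show ?thesis by (auto simp: g_def some)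
  qed
  have g_triangle: "g {v, w} + g {u, w} + g {u, v} = 0" if "{u, v, w} \<in> vietoris_rips X t" for u v w
  proof -
    have X': "u \<in> X" "v \<in> X" "w \<in> X" and d: "dist u v \<le> t" "dist v w \<le> t" "dist u w \<le> t"
      using that by (auto simp: vietoris_rips_def)
    have "n (p u) (p w) = n (p u) (p v) + n (p v) (p w)"
      using X' d p p_dist by (intro cocycle) auto
    then have "g {u, w} = g {u, v} + g {v, w}" using X' d by (simp add: g)
    then show ?thesis by (cases "g {u, v}"; cases "g {v, w}") simp_all
  qed

  define E :: "nat \<Rightarrow> 'a chain" where
    "E i = (if x i = x (Suc i) then 0 else Poly_Mapping.single {x i, x (Suc i)} 1)" for i
  have "(\<Sum>i<N. E i) \<in> cycles 1 (vietoris_rips X (2 * \<rho> + \<kappa>))"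
    unfolding cycles_def mem_Collect_eq
  proof
    show "(\<Sum>i<N. E i) \<in> chains 1 (vietoris_rips X (2 * \<rho> + \<kappa>))"
    proof (rule chains_sum)
      fix i assume "i \<in> {..<N}"
      then have "x i \<in> X" "x (Suc i) \<in> X" "dist (x i) (x (Suc i)) \<le> 2 * \<rho> + \<kappa>"
        using x(1) x_step by auto
      then have "{x i, x (Suc i)} \<in> vietoris_rips X (2 * \<rho> + \<kappa>)"
        using \<rho> pos(1) by (simp add: vietoris_rips_def dist_commute)
      then show "E i \<in> chains 1 (vietoris_rips X (2 * \<rho> + \<kappa>))"
        by (simp add: E_def chains_def)
    qed
    show "boundary (\<Sum>i<N. E i) = 0"
      unfolding E_def using z_closed by (intro polygon_is_cycle) (simp add: x_def)
  qed
  moreover have "(\<Sum>i<N. E i) \<notin> boundaries 1 (vietoris_rips X t)"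
  proof
    assume "(\<Sum>i<N. E i) \<in> boundaries 1 (vietoris_rips X t)"
    then have "extend_linearly g (\<Sum>i<N. E i) = 0"
      using g_triangle by (intro cocycle_vanishes_on_boundaries) auto
    moreover have "extend_linearly g (E i) = of_int (n (y i) (y (Suc i)))" if "i < N" for i
    proof (cases "x i = x (Suc i)")
      case True
      then show ?thesis using n_refl[of "y i"] y(1)[of i] that by (simp add: E_def y_def)
    next
      case False
      then show ?thesis
        using g[of "x i" "x (Suc i)"] x(1) x_step[OF that] that scales(1) by (simp add: E_def y_def)
    qed
    ultimately have "(\<Sum>i<N. of_int (n (y i) (y (Suc i)))) = (0::bit)"
      by (simp add: extend_linearly_sum[OF bit_add_self])
    then have "of_int (\<Sum>i<N. n (y i) (y (Suc i))) = (0::bit)" by simp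
    then show False unfolding y_winding by simp
  qed
  ultimately show thesis
    using persistent_cycle_yields_diagram_point[OF X, of 1 "2 * \<rho> + \<kappa>" t] scales(1) that by blast
qed

text \<open>
  Every \<open>e < \<surd>2 * R\<close> is admissible for the curve.  With \<open>e = 7/5 * R\<close> and a subdivision of mesh
  \<open>R/10\<close>, a class is present at scale \<open>2\<delta> + 2q + R/10\<close> and still alive at \<open>7/5 * R - 2q\<close>; as
  \<open>\<surd>(3/10) < 11/20\<close>, the length of this range exceeds the asserted one.
\<close>

lemma noisy_sample_diagram_point:
  fixes \<gamma> :: "real \<Rightarrow> 'a::euclidean_space"
  assumes \<gamma>: "continuous_on {0..1} \<gamma>" "\<gamma> 0 = \<gamma> 1" "inj_on \<gamma> {0..<1}"
    and K: "K = \<gamma> ` {0..1}" and R: "reach K = ennreal R" "0 < R"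
    and P: "finite P" "P \<noteq> {}" "P \<subseteq> K" "hausdorff_dist P K \<le> \<delta>"
    and X: "finite X" "X \<noteq> {}" "hausdorff_dist P X \<le> q"
    and noise: "4 * q < 2 * (sqrt (3/10) * R - 2 * \<delta>)"
  obtains b d where "(b, d) \<in># persistence_diagram 1 X"
    "2 * (sqrt (3/10) * R - 2 * \<delta>) - 4 * q \<le> d - b"
proof -
  have compact: "compact K" "compact P" "compact X"
    unfolding K using compact_continuous_image[OF \<gamma>(1) compact_Icc] finite_imp_compact P(1) X(1) by blast+
  have "K \<noteq> {}" using P(2,3) by blast
  have K_to_P: "\<exists>y\<in>P. dist z y \<le> \<delta>" if "z \<in> K" for z
    using hausdorff_dist_nearby(2)[OF compact(2,1) P(2) _ P(4) that] \<open>K \<noteq> {}\<close> by blast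
  have P_to_X: "\<exists>x\<in>X. dist y x \<le> q" if "y \<in> P" for y
    using hausdorff_dist_nearby(1)[OF compact(2,3) P(2) X(2,3) that] .
  have X_to_P: "\<exists>y\<in>P. dist x y \<le> q" if "x \<in> X" for x
    using hausdorff_dist_nearby(2)[OF compact(2,3) P(2) X(2,3) that] .
  have nonneg: "0 \<le> \<delta>" "0 \<le> q"
    using K_to_P X_to_P X(2) \<open>K \<noteq> {}\<close> by (meson equals0I order_trans zero_le_dist)+
  define s where "s = sqrt (3/10) * R"
  have "sqrt (3/10) \<le> 11/20" by (rule real_le_lsqrt) (simp_all add: power2_eq_square)
  then have s: "s \<le> 11/20 * R" unfolding s_def using R(2) by (intro mult_right_mono) auto
  have unique: "\<And>x. infdist x K < R \<Longrightarrow> \<exists>!y. y \<in> K \<and> dist x y = infdist x K"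
    using nearest_point_unique_within_reach[OF R(1)] .
  have near_X: "\<exists>x\<in>X. dist z x \<le> \<delta> + q" if z: "z \<in> K" for z
  proof -
    obtain y where y: "y \<in> P" "dist z y \<le> \<delta>" using K_to_P[OF z] by blast
    obtain x where x: "x \<in> X" "dist y x \<le> q" using P_to_X[OF y(1)] by blast
    have "dist z x \<le> \<delta> + q" using dist_triangle[of z x y] x(2) y(2) by linarith
    then show ?thesis using x(1) by blast
  qed
  have near_K: "\<exists>z\<in>K. dist x z \<le> q" if "x \<in> X" for x
    using X_to_P[OF that] P(3) by blast
  have e: "(7/5 * R)\<^sup>2 < 2 * R\<^sup>2" using R(2) by (simp add: power2_eq_square)
  obtain b d where bd: "(b, d) \<in># persistence_diagram 1 X"
    "b \<le> 2 * (\<delta> + q) + R/10" "7/5 * R - 2 * q < d"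
  proof (rule sampled_closed_curve_diagram_point[OF \<gamma> K unique e R(2) X(1) near_X near_K])
    show "2 * (\<delta> + q) + R/10 \<le> 7/5 * R - 2 * q"
      using noise[folded s_def] s nonneg R(2) by argo
    show "\<delta> + q + q + R/10 \<le> 7/5 * R"
      using noise[folded s_def] s nonneg R(2) by argo
  qed (use R(2) nonneg in auto)
  have "2 * (sqrt (3/10) * R - 2 * \<delta>) - 4 * q \<le> d - b"
    unfolding s_def[symmetric] using bd(2,3) s nonneg R(2) by argo
  then show thesis using that bd(1) by blast
qed

section \<open>Attractors near a Hopf bifurcation\<close>

text \<open>
  Rescaling time by the period; the fractional part of the rescaled time brings every point of the
  orbit into one period.
\<close>

lemma periodic_orbit_parametrization:
  fixes F :: "'a::real_normed_vector \<Rightarrow> 'a"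
  assumes "periodic_orbit F \<Gamma>"
  obtains \<gamma> where "continuous_on {0..1::real} \<gamma>" "\<gamma> 0 = \<gamma> 1" "inj_on \<gamma> {0..<1}" "\<Gamma> = \<gamma> ` {0..1}"
proof -
  obtain u T where T: "T > 0" and sol: "solves_ode F u UNIV" and per: "\<And>t. u (t + T) = u t"
      and inj: "inj_on u {0..<T}" and \<Gamma>: "\<Gamma> = range u"
    using assms by (auto simp: periodic_orbit_def)
  interpret periodic_fun_simple u T by standard (rule per)
  let ?\<gamma> = "\<lambda>t. u (t * T)"
  have cont: "continuous_on S u" for S
    using sol by (intro continuous_at_imp_continuous_on ballI has_vector_derivative_continuous)
      (auto simp: solves_ode_def)
  have "continuous_on {0..1} ?\<gamma>"
    by (intro continuous_on_compose2[OF cont] continuous_intros) auto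
  moreover have "?\<gamma> 0 = ?\<gamma> 1" using per[of 0] by simp
  moreover have "inj_on ?\<gamma> {0..<1}"
  proof (rule inj_onI)
    fix s t assume st: "s \<in> {0..<1}" "t \<in> {0..<1}" "?\<gamma> s = ?\<gamma> t"
    then have "s * T = t * T" using T by (intro inj_onD[OF inj]) auto
    then show "s = t" using T by simp
  qed
  moreover have "range u = ?\<gamma> ` {0..1}"
  proof (intro subset_antisym subsetI)
    fix y assume "y \<in> range u"
    then obtain s where s: "y = u s" by blast
    have "u s = u (frac (s / T) * T + of_int \<lfloor>s / T\<rfloor> * T)"
      using T by (simp add: frac_def flip: distrib_right)
    also have "\<dots> = ?\<gamma> (frac (s / T))" by (rule plus_of_int)
    finally show "y \<in> ?\<gamma> ` {0..1}"
      unfolding s using frac_ge_0[of "s / T"] frac_lt_1[of "s / T"] by (intro image_eqI) auto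
  qed auto
  ultimately show thesis using that \<Gamma> by metis
qed

lemma embedding_on_continuous:
  assumes "embedding_on A \<Phi>"
  shows "continuous_on A \<Phi>"
proof -
  obtain U g where "A \<subseteq> U" "Ck_on 1 U g" "\<forall>x\<in>A. g x = \<Phi> x"
    using assms by (auto simp: embedding_on_def)
  then have "continuous_on A g"
    by (intro differentiable_imp_continuous_on) (auto simp: differentiable_on_def intro: differentiable_at_withinI)
  then show ?thesis using \<open>\<forall>x\<in>A. g x = \<Phi> x\<close> by (simp cong: continuous_on_cong)
qed

theorem theorem1:
  fixes f :: "real^'n \<Rightarrow> real \<Rightarrow> real^'n"
    and h :: "real^'n \<Rightarrow> real"
    and \<tau> \<mu>c :: real
    and J :: "real set"
    and xs :: "real \<Rightarrow> real^'n"
    and \<Gamma> A :: "real \<Rightarrow> (real^'n) set"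
    and \<Phi> :: "real \<Rightarrow> real^'n \<Rightarrow> real^'m::{finite,linorder}"
    and M P X :: "real \<Rightarrow> (real^'m::{finite,linorder}) set"
    and R \<delta> q \<eta> :: "real \<Rightarrow> real"
  assumes hopf: "supercritical_hopf f \<mu>c J xs \<Gamma>"
    and tau: "\<tau> > 0"
    and A_eq: "A = attracting_set \<mu>c xs \<Gamma>"
    and Phi_eq: "\<Phi> = (\<lambda>\<mu>. delay_map (\<lambda>x. f x \<mu>) h \<tau>)"
    and embedding: "\<And>\<mu>. \<mu> \<in> J \<Longrightarrow> \<mu> \<noteq> \<mu>c \<Longrightarrow> embedding_on (A \<mu>) (\<Phi> \<mu>)"
    and M_eq: "M = (\<lambda>\<mu>. \<Phi> \<mu> ` A \<mu>)"
    and P_below: "\<And>\<mu>. \<mu> \<in> J \<Longrightarrow> \<mu> < \<mu>c \<Longrightarrow> P \<mu> = M \<mu>"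
    and P_above: "\<And>\<mu>. \<mu> \<in> J \<Longrightarrow> \<mu> > \<mu>c \<Longrightarrow> finite (P \<mu>) \<and> P \<mu> \<noteq> {} \<and> P \<mu> \<subseteq> M \<mu>"
    and P_dense: "\<And>\<mu>. \<mu> \<in> J \<Longrightarrow> \<mu> > \<mu>c \<Longrightarrow> hausdorff_dist (P \<mu>) (M \<mu>) \<le> \<delta> \<mu>"
    and R_reach: "\<And>\<mu>. \<mu> \<in> J \<Longrightarrow> \<mu> > \<mu>c \<Longrightarrow> reach (M \<mu>) = ennreal (R \<mu>) \<and> R \<mu> > 0"
    and delta_less: "\<And>\<mu>. \<mu> \<in> J \<Longrightarrow> \<mu> > \<mu>c \<Longrightarrow> \<delta> \<mu> < 1/2 * sqrt (3/10) * R \<mu>"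
    and X_finite: "\<And>\<mu>. \<mu> \<in> J \<Longrightarrow> \<mu> \<noteq> \<mu>c \<Longrightarrow> finite (X \<mu>) \<and> X \<mu> \<noteq> {}"
    and X_close: "\<And>\<mu>. \<mu> \<in> J \<Longrightarrow> \<mu> \<noteq> \<mu>c \<Longrightarrow> hausdorff_dist (P \<mu>) (X \<mu>) \<le> q \<mu>"
    and eta_eq: "\<eta> = (\<lambda>\<mu>. 2 * (sqrt (3/10) * R \<mu> - 2 * \<delta> \<mu>))"
  shows "\<forall>\<mu>\<in>J.
           (\<mu> < \<mu>c \<longrightarrow> max_persistence (X \<mu>) \<le> 4 * q \<mu>) \<and>
           (\<mu> > \<mu>c \<longrightarrow>
              \<eta> \<mu> > 0 \<and>
              max_persistence (X \<mu>) \<ge> \<eta> \<mu> - 4 * q \<mu> \<and>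
              (\<eta> \<mu> > 4 * q \<mu> \<longrightarrow>
                 \<eta> \<mu> - 4 * q \<mu> > 0 \<and>
                 (\<exists>(b, d) \<in> set_mset (persistence_diagram 1 (X \<mu>)). d - b \<ge> \<eta> \<mu> - 4 * q \<mu>)))"
proof (intro ballI conjI impI)
  fix \<mu> assume \<mu>: "\<mu> \<in> J" "\<mu> < \<mu>c"
  obtain p where p: "P \<mu> = {p}"
    using P_below[OF \<mu>] \<mu>(2) by (simp add: M_eq A_eq attracting_set_def)
  have X: "finite (X \<mu>)" "X \<mu> \<noteq> {}" "hausdorff_dist {p} (X \<mu>) \<le> q \<mu>"
    using X_finite[of \<mu>] X_close[of \<mu>] \<mu> p by auto
  have near: "dist x p \<le> q \<mu>" if "x \<in> X \<mu>" for x
    using hausdorff_dist_nearby(2)[of "{p}" "X \<mu>" "q \<mu>" x] X that finite_imp_compact by auto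
  have diam: "dist x y \<le> 2 * q \<mu>" if "x \<in> X \<mu>" "y \<in> X \<mu>" for x y
    using near[OF that(1)] near[OF that(2)] dist_triangle2[of x y p] by linarith
  obtain x where "x \<in> X \<mu>" using X(2) by blast
  then have q: "0 \<le> q \<mu>" using near[of x] zero_le_dist[of x p] by linarith
  show "max_persistence (X \<mu>) \<le> 4 * q \<mu>"
  proof (rule max_persistence_le)
    fix b d assume "(b, d) \<in># persistence_diagram 1 (X \<mu>)"
    then have "d - b \<le> 2 * q \<mu>" using persistence_le_diameter[OF X(1) diam] by blast
    then show "d - b \<le> 4 * q \<mu>" using q by linarith
  qed (use q in simp)
next
  fix \<mu> assume \<mu>: "\<mu> \<in> J" "\<mu> > \<mu>c"
  show "\<eta> \<mu> > 0" using delta_less[OF \<mu>] by (simp add: eta_eq mult.commute)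

  have A: "A \<mu> = \<Gamma> \<mu>" using \<mu>(2) by (simp add: A_eq attracting_set_def)
  have "periodic_orbit (\<lambda>x. f x \<mu>) (\<Gamma> \<mu>)" using hopf \<mu> by (simp add: supercritical_hopf_def)
  then obtain u where u: "continuous_on {0..1::real} u" "u 0 = u 1" "inj_on u {0..<1}" "A \<mu> = u ` {0..1}"
    unfolding A by (rule periodic_orbit_parametrization)
  have emb: "embedding_on (A \<mu>) (\<Phi> \<mu>)" using embedding[of \<mu>] \<mu> by simp
  define \<gamma> where "\<gamma> = \<Phi> \<mu> \<circ> u"
  have \<gamma>: "continuous_on {0..1} \<gamma>" "\<gamma> 0 = \<gamma> 1" "inj_on \<gamma> {0..<1}" "M \<mu> = \<gamma> ` {0..1}"
  proof -
    show "continuous_on {0..1} \<gamma>"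
      using embedding_on_continuous[OF emb] unfolding \<gamma>_def u(4)
      by (intro continuous_on_compose u(1))
    have "inj_on (\<Phi> \<mu>) (u ` {0..<1})"
      using emb unfolding embedding_on_def u(4) by (rule inj_on_subset[OF conjunct1]) auto
    then show "inj_on \<gamma> {0..<1}" unfolding \<gamma>_def by (rule comp_inj_on[OF u(3)])
    show "\<gamma> 0 = \<gamma> 1" "M \<mu> = \<gamma> ` {0..1}" using u(2,4) by (simp_all add: \<gamma>_def M_eq image_comp)
  qed
  have point: "\<exists>b d. (b, d) \<in># persistence_diagram 1 (X \<mu>) \<and> \<eta> \<mu> - 4 * q \<mu> \<le> d - b"
    if "\<eta> \<mu> > 4 * q \<mu>"
    using noisy_sample_diagram_point[OF \<gamma>, of "R \<mu>" "P \<mu>" "\<delta> \<mu>" "X \<mu>" "q \<mu>"]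
      R_reach[OF \<mu>] P_above[OF \<mu>] P_dense[OF \<mu>] X_finite[of \<mu>] X_close[of \<mu>] \<mu> that
    unfolding eta_eq by blast
  show "max_persistence (X \<mu>) \<ge> \<eta> \<mu> - 4 * q \<mu>"
  proof (cases "\<eta> \<mu> > 4 * q \<mu>")
    case True
    then show ?thesis using point max_persistence_ge order_trans by blast
  next
    case False
    then show ?thesis using max_persistence_nonneg[of "X \<mu>"] X_finite[of \<mu>] \<mu> by simp
  qed
  show "\<eta> \<mu> - 4 * q \<mu> > 0" if "\<eta> \<mu> > 4 * q \<mu>" using that by simp
  show "\<exists>(b, d) \<in> set_mset (persistence_diagram 1 (X \<mu>)). d - b \<ge> \<eta> \<mu> - 4 * q \<mu>"
    if "\<eta> \<mu> > 4 * q \<mu>" using point[OF that] by blast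
qed

end
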